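(* Let $(X_0,X_1)$ be a Banach couple with continuous embedding $X_1\hookrightarrow X_0$. For every $1<q<\infty$ there is a constant $C_q$, independent of $T$ and $u$, such that the following holds for all $0<T<\infty$. Assume $$u\in BMO_*(0,T;X_1),\qquad u'\in BMO_*(0,T;X_0),$$ where $u'$ is the $X_0$-valued distributional derivative. Then (after modification on a null set) $$u\in C\bigl([0,T];(X_0,X_1)_{1-1/q,q}\bigr),$$ and $$\|u\|_{C([0,T];(X_0,X_1)_{1-1/q,q})}\le C_q\Bigl(\|u\|_{BMO_*(0,T;X_1)}+T\,\|u'\|_{BMO_*(0,T;X_0)}\Bigr).$$
   Context: For a Banach space $X$ and $g\in L^1(0,T;X)$ put $g_I:=\frac1{|I|}\int_I g(t)\,dt$ for intervals $I\subset(0,T)$, $$[g]_{BMO(0,T;X)}:=\sup_{I\subset(0,T)}\frac1{|I|}\int_I\|g(t)-g_I\|_X\,dt,\qquad \|g\|_{BMO_*(0,T;X)}:=\|g_{(0,T)}\|_X+[g]_{BMO(0,T;X)},$$ the supremum being over all intervals $I\subset(0,T)$; $BMO_*(0,T;X)$ is the space of $g$ with finite $\|g\|_{BMO_*(0,T;X)}$. A Banach couple is a pair of Banach spaces continuously embedded in a common Hausdorff topological vector space. For $x\in X_0+X_1$ and $r>0$, $$K(r,x;X_0,X_1):=\inf\{\|x_0\|_{X_0}+r\|x_1\|_{X_1}: x=x_0+x_1,\ x_0\in X_0,\ x_1\in X_1\}.$$ For $0<\theta<1$ and $1\le q<\infty$, $(X_0,X_1)_{\theta,q}$ is the set of $x\in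 X_0+X_1$ with $$\|x\|_{(X_0,X_1)_{\theta,q}}:=\Bigl(\int_0^\infty\bigl(r^{-\theta}K(r,x;X_0,X_1)\bigr)^q\,\frac{dr}{r}\Bigr)^{1/q}<\infty.$$ The norm of $C([0,T];Y)$ is the supremum norm. *)

theory Defs
  imports "HOL-Analysis.Analysis"
begin

text \<open>The library's \<^verbatim>\<open>has_bochner_integral\<close> is restricted to second countable
  (that is, separable) value spaces. The following drops this restriction and is otherwise the
  same definition; the approximation by simple functions entails strong measurability.\<close>

definition has_bochner ::
    "'m measure \<Rightarrow> ('m \<Rightarrow> 'x::real_normed_vector) \<Rightarrow> 'x \<Rightarrow> bool" where
  "has_bochner M f x \<longleftrightarrow> f \<in> borel_measurable M \<and>
     (\<exists>s. (\<forall>n::nat. Bochner_Integration.simple_bochner_integrable M (s n)) \<and>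
          (\<lambda>n. \<integral>\<^sup>+t. ennreal (norm (f t - s n t)) \<partial>M) \<longlonglongrightarrow> 0 \<and>
          (\<lambda>n. Bochner_Integration.simple_bochner_integral M (s n)) \<longlonglongrightarrow> x)"

lemma has_bochner_eq_library:
  fixes f :: "'m \<Rightarrow> 'x::{real_normed_vector, second_countable_topology}"
  shows "has_bochner M f x \<longleftrightarrow> has_bochner_integral M f x"
  unfolding has_bochner_def has_bochner_integral.simps by blast

definition bochner_integrable :: "'m measure \<Rightarrow> ('m \<Rightarrow> 'x::real_normed_vector) \<Rightarrow> bool" where
  "bochner_integrable M f \<longleftrightarrow> (\<exists>x. has_bochner M f x)"

definition bochner_integral :: "'m measure \<Rightarrow> ('m \<Rightarrow> 'x::real_normed_vector) \<Rightarrow> 'x" where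
  "bochner_integral M f = (if bochner_integrable M f then THE x. has_bochner M f x else 0)"

definition interval_mean :: "real set \<Rightarrow> (real \<Rightarrow> 'x::real_normed_vector) \<Rightarrow> 'x" where
  "interval_mean I g = (1 / measure lebesgue I) *\<^sub>R bochner_integral (lebesgue_on I) g"

definition BMO_seminorm :: "real \<Rightarrow> (real \<Rightarrow> 'x::real_normed_vector) \<Rightarrow> ennreal" where
  "BMO_seminorm T g =
     (SUP I \<in> {I. is_interval I \<and> I \<subseteq> {0<..<T} \<and> 0 < measure lebesgue I}.
        (\<integral>\<^sup>+t. ennreal (norm (g t - interval_mean I g)) \<partial>lebesgue_on I)
          / ennreal (measure lebesgue I))"

definition BMO_star_norm :: "real \<Rightarrow> (real \<Rightarrow> 'x::real_normed_vector) \<Rightarrow> ennreal" where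
  "BMO_star_norm T g = ennreal (norm (interval_mean {0<..<T} g)) + BMO_seminorm T g"

definition BMO_star :: "real \<Rightarrow> (real \<Rightarrow> 'x::real_normed_vector) set" where
  "BMO_star T = {g. bochner_integrable (lebesgue_on {0<..<T}) g \<and> BMO_star_norm T g < \<infinity>}"

definition test_function :: "real \<Rightarrow> (real \<Rightarrow> real) \<Rightarrow> bool" where
  "test_function T \<phi> \<longleftrightarrow>
     (\<forall>n t. ((deriv ^^ n) \<phi>) differentiable (at t)) \<and> closure {t. \<phi> t \<noteq> 0} \<subseteq> {0<..<T}"

text \<open>\<^verbatim>\<open>distributional_derivative T f w\<close> says \<^verbatim>\<open>f' = w\<close> in the
  sense of distributions on the interval \<^verbatim>\<open>(0, T)\<close>; it is meant for functions
  that are Bochner integrable there.\<close>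

definition distributional_derivative ::
    "real \<Rightarrow> (real \<Rightarrow> 'x::real_normed_vector) \<Rightarrow> (real \<Rightarrow> 'x) \<Rightarrow> bool" where
  "distributional_derivative T f w \<longleftrightarrow>
     (\<forall>\<phi>. test_function T \<phi> \<longrightarrow>
        bochner_integral (lebesgue_on {0<..<T}) (\<lambda>t. deriv \<phi> t *\<^sub>R f t) =
          - bochner_integral (lebesgue_on {0<..<T}) (\<lambda>t. \<phi> t *\<^sub>R w t))"

text \<open>A couple is given by two Banach spaces, as types, and their embeddings
  \<^verbatim>\<open>j0\<close>, \<^verbatim>\<open>j1\<close> into the ambient space. The sort of the ambient type
  makes addition continuous and the topology Hausdorff; continuity of scalar multiplication
  is the first conjunct.\<close>

definition banach_couple ::
    "('a::banach \<Rightarrow> 'v::{real_vector, topological_ab_group_add, t2_space}) \<Rightarrow>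
     ('b::banach \<Rightarrow> 'v) \<Rightarrow> bool" where
  "banach_couple j0 j1 \<longleftrightarrow>
     continuous_on UNIV (\<lambda>p::real \<times> 'v. fst p *\<^sub>R snd p) \<and>
     linear j0 \<and> inj j0 \<and> continuous_on UNIV j0 \<and>
     linear j1 \<and> inj j1 \<and> continuous_on UNIV j1"

definition couple_sum ::
    "('a::real_normed_vector \<Rightarrow> 'v::real_vector) \<Rightarrow> ('b::real_normed_vector \<Rightarrow> 'v) \<Rightarrow> 'v set" where
  "couple_sum j0 j1 = {j0 x0 + j1 x1 | x0 x1. True}"

definition K_functional ::
    "('a::real_normed_vector \<Rightarrow> 'v::real_vector) \<Rightarrow> ('b::real_normed_vector \<Rightarrow> 'v) \<Rightarrow>
     real \<Rightarrow> 'v \<Rightarrow> real" where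
  "K_functional j0 j1 r x = Inf {norm x0 + r * norm x1 | x0 x1. x = j0 x0 + j1 x1}"

definition interp_integral ::
    "('a::real_normed_vector \<Rightarrow> 'v::real_vector) \<Rightarrow> ('b::real_normed_vector \<Rightarrow> 'v) \<Rightarrow>
     real \<Rightarrow> real \<Rightarrow> 'v \<Rightarrow> ennreal" where
  "interp_integral j0 j1 \<theta> q x =
     (\<integral>\<^sup>+r. ennreal ((r powr (- \<theta>) * K_functional j0 j1 r x) powr q / r)
        \<partial>lebesgue_on {0<..})"

definition interp_space ::
    "('a::real_normed_vector \<Rightarrow> 'v::real_vector) \<Rightarrow> ('b::real_normed_vector \<Rightarrow> 'v) \<Rightarrow>
     real \<Rightarrow> real \<Rightarrow> 'v set" where
  "interp_space j0 j1 \<theta> q = {x \<in> couple_sum j0 j1. interp_integral j0 j1 \<theta> q x < \<infinity>}"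

text \<open>Only meaningful on \<^verbatim>\<open>interp_space\<close>, where the integral is finite.\<close>

definition interp_norm ::
    "('a::real_normed_vector \<Rightarrow> 'v::real_vector) \<Rightarrow> ('b::real_normed_vector \<Rightarrow> 'v) \<Rightarrow>
     real \<Rightarrow> real \<Rightarrow> 'v \<Rightarrow> real" where
  "interp_norm j0 j1 \<theta> q x = enn2real (interp_integral j0 j1 \<theta> q x) powr (1 / q)"

text \<open>Membership in \<^verbatim>\<open>C([0,T]; Y)\<close> for the interpolation space
  \<^verbatim>\<open>Y\<close>, which carries the topology of its own norm, not that of the ambient type.\<close>

definition continuous_into_interp ::
    "('a::real_normed_vector \<Rightarrow> 'v::real_vector) \<Rightarrow> ('b::real_normed_vector \<Rightarrow> 'v) \<Rightarrow>
     real \<Rightarrow> real \<Rightarrow> real \<Rightarrow> (real \<Rightarrow> 'v) \<Rightarrow> bool" where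
  "continuous_into_interp j0 j1 \<theta> q T v \<longleftrightarrow>
     (\<forall>t\<in>{0..T}. v t \<in> interp_space j0 j1 \<theta> q) \<and>
     (\<forall>t\<in>{0..T}. ((\<lambda>s. interp_norm j0 j1 \<theta> q (v s - v t)) \<longlongrightarrow> 0) (at t within {0..T}))"

definition sup_interp_norm ::
    "('a::real_normed_vector \<Rightarrow> 'v::real_vector) \<Rightarrow> ('b::real_normed_vector \<Rightarrow> 'v) \<Rightarrow>
     real \<Rightarrow> real \<Rightarrow> real \<Rightarrow> (real \<Rightarrow> 'v) \<Rightarrow> ennreal" where
  "sup_interp_norm j0 j1 \<theta> q T v = (SUP t\<in>{0..T}. ennreal (interp_norm j0 j1 \<theta> q (v t)))"

end

theory Submission
  imports Defs "HOL-Computational_Algebra.Polynomial" "HOL-Real_Asymp.Real_Asymp"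
begin

text \<open>Over an interval of length \<open>T / 2 ^ k\<close> the mean of a BMO function has norm at most
  \<open>(1 + 2 k)\<close> times the BMO norm, since halving an interval changes the mean by at most
  twice the seminorm. Hence the mean of \<open>u\<close> over such an interval at \<open>t\<close> lies in \<open>X\<^sub>1\<close> with norm
  \<open>O(1 + k)\<close>, and its distance to \<open>u t\<close> in \<open>X\<^sub>0\<close>, being at most the integral of the norm of the
  derivative over the interval, is \<open>O(T (1 + k) / 2 ^ k)\<close>. With \<open>2 ^ - k\<close> comparable to \<open>r\<close> this splitting of
  \<open>u t\<close> bounds the K-functional by \<open>r (1 + ln (1 / r))\<close> for \<open>r \<le> 1\<close>, so that only the
  growth of the means is needed and not the John-Nirenberg inequality.

  The distributional derivative enters only through the comparison of two interval means. It makes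
  the means over shrinking intervals a Cauchy sequence, whose limit is the continuous
  representative; continuity in the interpolation norm follows by interpolating between the
  smallness of the increments in \<open>X\<^sub>0\<close> and the uniform bound of the K-functional.\<close>

section \<open>The Bochner integral in nonseparable spaces\<close>

text \<open>The spaces need not be separable, so the sum of two measurable functions can fail to be
  measurable. Integrals of a fixed \<open>f\<close> are therefore treated as functionals of a
  bounded real weight: \<open>f\<close> times a difference of weights is again \<open>f\<close>
  times one weight, which makes linearity in the weight available. Interval means, pairings with
  test functions and integrals over Borel sets all have this form.

  Equality of \<open>u\<close> with its representative is proved through integrals as well: the
  primitive of the difference has derivative 0, so all integrals of the difference over Borel sets
  vanish.

  The constant is independent of \<open>T\<close> because lengths are measured as fractions of
  \<open>T\<close>: the distance in the larger space then carries the factor \<open>T\<close> that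
  stands next to the norm of the derivative.

  The logarithm costs an arbitrarily small power of \<open>r\<close>. Since
  \<open>1 - 1 / q < 1\<close>, an exponent above \<open>1 - 1 / q\<close> remains after paying for
  it, and part of this excess is spent once more on continuity.\<close>

abbreviation "simple_integral_B \<equiv> Bochner_Integration.simple_bochner_integral"
abbreviation "simple_integrable_B \<equiv> Bochner_Integration.simple_bochner_integrable"

lemma simple_integrable_B_simple: "simple_integrable_B M s \<Longrightarrow> simple_function M s"
  by (auto elim: simple_bochner_integrable.cases)

text \<open>In a nonseparable space the sum of two measurable functions need not be measurable;
  this is the substitute.\<close>

lemma borel_measurable_combine_simple:
  fixes f :: "'m \<Rightarrow> 'x::topological_space"
  assumes "f \<in> borel_measurable M" and "simple_function M s"
    and "\<And>y. continuous_on UNIV (h y)"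
  shows "(\<lambda>x. h (s x) (f x)) \<in> borel_measurable M"
proof (rule measurable_compose_countable'[where f = "\<lambda>y x. h y (f x)" and g = s and I = "s ` space M"])
  show "(\<lambda>x. h y (f x)) \<in> borel_measurable M" for y
    by (rule measurable_compose[OF assms(1) borel_measurable_continuous_onI[OF assms(3)]])
  show "s \<in> measurable M (count_space (s ` space M))"
    by (rule measurable_count_space_extend[OF subset_UNIV _ measurable_simple_function[OF assms(2)]]) auto
  show "countable (s ` space M)"
    using assms(2) by (simp add: simple_function_def countable_finite)
qed

lemma borel_measurable_diff_simple:
  fixes f :: "'m \<Rightarrow> 'x::real_normed_vector"
  assumes "f \<in> borel_measurable M" and "simple_function M s"
  shows "(\<lambda>x. f x - s x) \<in> borel_measurable M"
  by (rule borel_measurable_combine_simple[OF assms, of "\<lambda>y z. z - y"]) (intro continuous_intros)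

lemma borel_measurable_norm_diff_simple:
  fixes f :: "'m \<Rightarrow> 'x::real_normed_vector"
  assumes "f \<in> borel_measurable M" and "simple_function M s"
  shows "(\<lambda>x. ennreal (norm (f x - s x))) \<in> borel_measurable M"
proof -
  have "(\<lambda>x. norm (f x - s x)) \<in> borel_measurable M"
    by (rule borel_measurable_combine_simple[OF assms, of "\<lambda>y z. norm (z - y)"]) (intro continuous_intros)
  then show ?thesis by measurable
qed

lemma borel_measurable_norm_simple:
  fixes s :: "'m \<Rightarrow> 'x::real_normed_vector"
  assumes "simple_function M s"
  shows "(\<lambda>x. ennreal (norm (s x))) \<in> borel_measurable M"
  using simple_function_compose1[OF assms, of norm] borel_measurable_simple_function by auto

lemma ennreal_norm_triangle:
  fixes a b c :: "'x::real_normed_vector"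
  shows "ennreal (norm (a - b)) \<le> ennreal (norm (c - a)) + ennreal (norm (c - b))"
proof -
  have "norm (a - b) \<le> norm (c - a) + norm (c - b)"
    using norm_triangle_ineq4[of "c - b" "c - a"] by simp
  then show ?thesis by (simp flip: ennreal_plus)
qed

lemma simple_integral_B_dist:
  fixes s t :: "'m \<Rightarrow> 'x::real_normed_vector"
  assumes s: "simple_integrable_B M s" and t: "simple_integrable_B M t"
  shows "ennreal (norm (simple_integral_B M s - simple_integral_B M t))
    \<le> (\<integral>\<^sup>+x. ennreal (norm (s x - t x)) \<partial>M)"
proof -
  have "ennreal (norm (simple_integral_B M s - simple_integral_B M t))
      = norm (simple_integral_B M (\<lambda>x. s x - t x))"
    using s t by (subst simple_bochner_integral_diff) auto
  also have "\<dots> \<le> simple_integral_B M (\<lambda>x. norm (s x - t x))"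
    using simple_bochner_integrable_compose2[of "(-)" M "s" "t"] s t
    by (auto intro!: simple_bochner_integral_norm_bound)
  also have "\<dots> = (\<integral>\<^sup>+x. norm (s x - t x) \<partial>M)"
    using simple_bochner_integrable_compose2[of "\<lambda>x y. norm (x - y)" M "s" "t"] s t
    by (auto intro!: simple_bochner_integral_eq_nn_integral)
  finally show ?thesis .
qed

text \<open>This estimate makes the integral independent of the approximating sequence and, in a
  Banach space, makes the integrals of the approximants a Cauchy sequence.\<close>

lemma simple_integral_B_bounded:
  fixes f :: "'m \<Rightarrow> 'x::real_normed_vector"
  assumes f: "f \<in> borel_measurable M"
    and s: "simple_integrable_B M s" and t: "simple_integrable_B M t"
  shows "ennreal (norm (simple_integral_B M s - simple_integral_B M t))
    \<le> (\<integral>\<^sup>+x. ennreal (norm (f x - s x)) \<partial>M) + (\<integral>\<^sup>+x. ennreal (norm (f x - t x)) \<partial>M)"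
proof -
  have "(\<integral>\<^sup>+x. ennreal (norm (s x - t x)) \<partial>M)
      \<le> (\<integral>\<^sup>+x. ennreal (norm (f x - s x)) + ennreal (norm (f x - t x)) \<partial>M)"
    by (intro nn_integral_mono ennreal_norm_triangle)
  also have "\<dots> = (\<integral>\<^sup>+x. ennreal (norm (f x - s x)) \<partial>M) + (\<integral>\<^sup>+x. ennreal (norm (f x - t x)) \<partial>M)"
    by (rule nn_integral_add[OF borel_measurable_norm_diff_simple[OF f simple_integrable_B_simple[OF s]]
          borel_measurable_norm_diff_simple[OF f simple_integrable_B_simple[OF t]]])
  finally show ?thesis
    using simple_integral_B_dist[OF s t] by (rule order_trans[rotated])
qed

lemma ennreal_tendsto_0_le:
  fixes X :: "nat \<Rightarrow> ennreal"
  assumes "A \<longlonglongrightarrow> 0" and "\<And>n. X n \<le> A n"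
  shows "X \<longlonglongrightarrow> 0"
  by (rule tendsto_sandwich[OF _ _ tendsto_const assms(1)]) (use assms(2) in auto)

lemma ennreal_norm_tendsto_0:
  fixes X :: "nat \<Rightarrow> 'x::real_normed_vector"
  assumes "\<And>n. ennreal (norm (X n)) \<le> A n" and "A \<longlonglongrightarrow> 0"
  shows "X \<longlonglongrightarrow> 0"
proof -
  have "(\<lambda>n. ennreal (norm (X n))) \<longlonglongrightarrow> 0"
    by (rule ennreal_tendsto_0_le[OF assms(2,1)])
  then have "(\<lambda>n. ennreal (norm (X n))) \<longlonglongrightarrow> ennreal 0"
    by simp
  then show ?thesis
    by (subst (asm) tendsto_ennreal_iff) (auto simp: tendsto_norm_zero_iff)
qed

lemma has_bochner_measurable: "has_bochner M f x \<Longrightarrow> f \<in> borel_measurable M"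
  by (simp add: has_bochner_def)

lemma bochner_integrable_measurable: "bochner_integrable M f \<Longrightarrow> f \<in> borel_measurable M"
  by (auto simp: bochner_integrable_def has_bochner_measurable)

text \<open>It allows an integral to be computed along a sequence chosen for the purpose, such as
  approximants cut down to a subset in \<open>has_bochner_restrict_space\<close>.\<close>

lemma has_bochner_approx_tendsto:
  assumes f: "has_bochner M f x" and s: "\<And>n. simple_integrable_B M (s n)"
    and lim: "(\<lambda>n. \<integral>\<^sup>+t. ennreal (norm (f t - s n t)) \<partial>M) \<longlonglongrightarrow> 0"
  shows "(\<lambda>n. simple_integral_B M (s n)) \<longlonglongrightarrow> x"
proof -
  from f obtain s' where fm: "f \<in> borel_measurable M"
    and s': "\<And>n. simple_integrable_B M (s' n)"
    and lim': "(\<lambda>n. \<integral>\<^sup>+t. ennreal (norm (f t - s' n t)) \<partial>M) \<longlonglongrightarrow> 0"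
    and x: "(\<lambda>n. simple_integral_B M (s' n)) \<longlonglongrightarrow> x"
    unfolding has_bochner_def by auto
  have "(\<lambda>n. simple_integral_B M (s n) - simple_integral_B M (s' n)) \<longlonglongrightarrow> 0"
    by (rule ennreal_norm_tendsto_0[OF simple_integral_B_bounded[OF fm s s']])
       (use tendsto_add[OF lim lim'] in simp)
  from tendsto_add[OF this x] show ?thesis by simp
qed

lemma has_bochner_unique:
  assumes "has_bochner M f x" "has_bochner M f y"
  shows "x = y"
proof -
  from assms(2) obtain s where s: "\<And>n. simple_integrable_B M (s n)"
    and lim: "(\<lambda>n. \<integral>\<^sup>+t. ennreal (norm (f t - s n t)) \<partial>M) \<longlonglongrightarrow> 0"
    and y: "(\<lambda>n. simple_integral_B M (s n)) \<longlonglongrightarrow> y"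
    unfolding has_bochner_def by auto
  show ?thesis
    by (rule LIMSEQ_unique[OF has_bochner_approx_tendsto[OF assms(1) s lim] y])
qed

lemma bochner_integral_eqI: "has_bochner M f x \<Longrightarrow> bochner_integral M f = x"
  unfolding bochner_integral_def bochner_integrable_def
  by (auto intro: the_equality has_bochner_unique)

lemma has_bochner_bochner_integral:
  "bochner_integrable M f \<Longrightarrow> has_bochner M f (bochner_integral M f)"
  unfolding bochner_integrable_def by (auto simp: bochner_integral_eqI)

lemma bochner_integrableI_approx:
  fixes f :: "'m \<Rightarrow> 'x::banach"
  assumes f: "f \<in> borel_measurable M" and s: "\<And>n. simple_integrable_B M (s n)"
    and lim: "(\<lambda>n. \<integral>\<^sup>+t. ennreal (norm (f t - s n t)) \<partial>M) \<longlonglongrightarrow> 0"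
  shows "bochner_integrable M f"
proof -
  have "Cauchy (\<lambda>n. simple_integral_B M (s n))"
  proof (rule metric_CauchyI)
    fix e :: real assume e: "0 < e"
    then have "0 < ennreal (e / 2)" by simp
    from order_tendstoD(2)[OF lim this] obtain N
      where N: "\<And>n. N \<le> n \<Longrightarrow> (\<integral>\<^sup>+t. ennreal (norm (f t - s n t)) \<partial>M) < ennreal (e / 2)"
      by (auto simp: eventually_sequentially)
    have "dist (simple_integral_B M (s m)) (simple_integral_B M (s n)) < e"
      if "N \<le> m" "N \<le> n" for m n
    proof -
      have "ennreal (norm (simple_integral_B M (s m) - simple_integral_B M (s n)))
          < ennreal (e / 2) + ennreal (e / 2)"
        by (intro order.strict_trans1[OF simple_integral_B_bounded[OF f s s]] add_strict_mono N that)
      also have "\<dots> = ennreal e"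
        using e by (simp flip: ennreal_plus)
      finally show ?thesis
        using e by (simp add: dist_norm ennreal_less_iff)
    qed
    then show "\<exists>N. \<forall>m\<ge>N. \<forall>n\<ge>N. dist (simple_integral_B M (s m)) (simple_integral_B M (s n)) < e"
      by blast
  qed
  then obtain x where "(\<lambda>n. simple_integral_B M (s n)) \<longlonglongrightarrow> x"
    using Cauchy_convergent convergent_def by blast
  then show ?thesis
    using assms unfolding bochner_integrable_def has_bochner_def by blast
qed

lemma has_bochner_simple:
  fixes s :: "'m \<Rightarrow> 'x::real_normed_vector"
  assumes "simple_integrable_B M s"
  shows "has_bochner M s (simple_integral_B M s)"
  unfolding has_bochner_def
  using assms by (auto intro!: exI[of _ "\<lambda>_. s"] borel_measurable_simple_function simple_integrable_B_simple)

lemma has_bochner_norm_le: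
  assumes "has_bochner M f x"
  shows "ennreal (norm x) \<le> (\<integral>\<^sup>+t. ennreal (norm (f t)) \<partial>M)"
proof -
  from assms obtain s where fm: "f \<in> borel_measurable M"
    and s: "\<And>n. simple_integrable_B M (s n)"
    and lim: "(\<lambda>n. \<integral>\<^sup>+t. ennreal (norm (f t - s n t)) \<partial>M) \<longlonglongrightarrow> 0"
    and x: "(\<lambda>n. simple_integral_B M (s n)) \<longlonglongrightarrow> x"
    unfolding has_bochner_def by auto
  have 0: "simple_integrable_B M (\<lambda>_. 0)"
    by (auto intro!: simple_bochner_integrable.intros)
  have zero: "simple_integral_B M (\<lambda>_. 0 :: 'b) = 0"
    unfolding simple_bochner_integral_def by (intro sum.neutral) auto
  have 1: "(\<lambda>n. ennreal (norm (simple_integral_B M (s n)))) \<longlonglongrightarrow> ennreal (norm x)"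
    using x by (intro tendsto_ennrealI tendsto_norm)
  have 2: "(\<lambda>n. (\<integral>\<^sup>+t. ennreal (norm (f t - s n t)) \<partial>M) + (\<integral>\<^sup>+t. ennreal (norm (f t)) \<partial>M))
      \<longlonglongrightarrow> 0 + (\<integral>\<^sup>+t. ennreal (norm (f t)) \<partial>M)"
    by (intro tendsto_add lim tendsto_const)
  have "ennreal (norm (simple_integral_B M (s n)))
      \<le> (\<integral>\<^sup>+t. ennreal (norm (f t - s n t)) \<partial>M) + (\<integral>\<^sup>+t. ennreal (norm (f t)) \<partial>M)" for n
    \<comment> \<open>Taking the simple function 0 as second approximant turns the Cauchy estimate
      into a norm bound.\<close>
    using simple_integral_B_bounded[OF fm s 0, of n] zero by simp
  then show ?thesis
    using LIMSEQ_le[OF 1 2] by auto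
qed

text \<open>Off the integrable functions the integral has the default value 0, so the bound holds
  there as well.\<close>

lemma bochner_integral_norm_le:
  "ennreal (norm (bochner_integral M f)) \<le> (\<integral>\<^sup>+t. ennreal (norm (f t)) \<partial>M)"
  using has_bochner_norm_le[OF has_bochner_bochner_integral, of M f]
  by (cases "bochner_integrable M f") (auto simp: bochner_integral_def)

lemma simple_integrable_B_finite_norm:
  fixes s :: "'m \<Rightarrow> 'x::real_normed_vector"
  assumes "simple_integrable_B M s"
  shows "(\<integral>\<^sup>+t. ennreal (norm (s t)) \<partial>M) < \<infinity>"
proof -
  have "simple_integrable_B M (\<lambda>t. norm (s t))"
    using simple_bochner_integrable_compose2[of "\<lambda>x y. norm x" M s s] assms by auto
  from simple_bochner_integral_eq_nn_integral[OF this, symmetric] show ?thesis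
    by simp
qed

lemma bochner_integrable_finite_norm:
  assumes "bochner_integrable M f"
  shows "(\<integral>\<^sup>+t. ennreal (norm (f t)) \<partial>M) < \<infinity>"
proof -
  from assms obtain s where fm: "f \<in> borel_measurable M"
    and s: "\<And>n::nat. simple_integrable_B M (s n)"
    and lim: "(\<lambda>n. \<integral>\<^sup>+t. ennreal (norm (f t - s n t)) \<partial>M) \<longlonglongrightarrow> 0"
    unfolding has_bochner_def bochner_integrable_def by auto
  from order_tendstoD(2)[OF lim, of \<infinity>] obtain n
    where n: "(\<integral>\<^sup>+t. ennreal (norm (f t - s n t)) \<partial>M) < \<infinity>"
    by (auto simp: eventually_sequentially)
  have "(\<integral>\<^sup>+t. ennreal (norm (f t)) \<partial>M)
      \<le> (\<integral>\<^sup>+t. ennreal (norm (f t - s n t)) + ennreal (norm (s n t)) \<partial>M)"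
    by (intro nn_integral_mono) (metis add.commute ennreal_leI ennreal_plus norm_ge_zero norm_triangle_sub)
  also have "\<dots> = (\<integral>\<^sup>+t. ennreal (norm (f t - s n t)) \<partial>M) + (\<integral>\<^sup>+t. ennreal (norm (s n t)) \<partial>M)"
    by (rule nn_integral_add[OF borel_measurable_norm_diff_simple[OF fm simple_integrable_B_simple[OF s]]
          borel_measurable_norm_simple[OF simple_integrable_B_simple[OF s]]])
  also have "\<dots> < \<infinity>"
    using n simple_integrable_B_finite_norm[OF s, of n] by simp
  finally show ?thesis .
qed

lemma has_bochner_bounded_linear:
  assumes "bounded_linear L" and "has_bochner M f x"
  shows "has_bochner M (\<lambda>t. L (f t)) (L x)"
proof -
  interpret L: bounded_linear L by fact
  from assms(2) obtain s where fm: "f \<in> borel_measurable M"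
    and s: "\<And>n. simple_integrable_B M (s n)"
    and lim: "(\<lambda>n. \<integral>\<^sup>+t. ennreal (norm (f t - s n t)) \<partial>M) \<longlonglongrightarrow> 0"
    and x: "(\<lambda>n. simple_integral_B M (s n)) \<longlonglongrightarrow> x"
    unfolding has_bochner_def by auto
  from L.nonneg_bounded obtain K where K: "0 \<le> K" "\<And>y. norm (L y) \<le> norm y * K" by blast
  show ?thesis
    unfolding has_bochner_def
  proof (intro conjI exI allI)
    show "(\<lambda>t. L (f t)) \<in> borel_measurable M"
      by (rule measurable_compose[OF fm borel_measurable_continuous_onI[OF L.continuous_on[OF continuous_on_id]]])
    show "simple_integrable_B M (\<lambda>t. L (s n t))" for n
      by (rule simple_bochner_integrable_compose2[OF _ s s, of "\<lambda>x y. L x"]) (rule L.zero)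
    have "(\<lambda>n. simple_integral_B M (\<lambda>t. L (s n t))) = (\<lambda>n. L (simple_integral_B M (s n)))"
      by (intro ext simple_bochner_integral_linear L.linear_axioms s)
    then show "(\<lambda>n. simple_integral_B M (\<lambda>t. L (s n t))) \<longlonglongrightarrow> L x"
      using L.tendsto[OF x] by simp
    have K0: "(\<lambda>n. ennreal K * (\<integral>\<^sup>+t. ennreal (norm (f t - s n t)) \<partial>M)) \<longlonglongrightarrow> 0"
      using ennreal_tendsto_cmult[OF _ lim, of "ennreal K"] by simp
    have "(\<integral>\<^sup>+t. ennreal (norm (L (f t) - L (s n t))) \<partial>M)
        \<le> ennreal K * (\<integral>\<^sup>+t. ennreal (norm (f t - s n t)) \<partial>M)" for n
    proof (subst nn_integral_cmult[symmetric])
      show "(\<lambda>t. ennreal (norm (f t - s n t))) \<in> borel_measurable M"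
        by (rule borel_measurable_norm_diff_simple[OF fm simple_integrable_B_simple[OF s]])
      show "(\<integral>\<^sup>+t. ennreal (norm (L (f t) - L (s n t))) \<partial>M)
          \<le> (\<integral>\<^sup>+t. ennreal K * ennreal (norm (f t - s n t)) \<partial>M)"
        using K by (intro nn_integral_mono)
          (simp add: L.diff[symmetric] mult.commute flip: ennreal_mult)
    qed
    then show "(\<lambda>n. \<integral>\<^sup>+t. ennreal (norm (L (f t) - L (s n t))) \<partial>M) \<longlonglongrightarrow> 0"
      by (rule ennreal_tendsto_0_le[OF K0])
  qed
qed

text \<open>The measurability of the difference has to be assumed here, see above.\<close>

lemma has_bochner_diff:
  assumes f: "has_bochner M f x" and g: "has_bochner M g y"
    and m: "(\<lambda>t. f t - g t) \<in> borel_measurable M"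
  shows "has_bochner M (\<lambda>t. f t - g t) (x - y)"
proof -
  from f obtain s where fm: "f \<in> borel_measurable M"
    and s: "\<And>n. simple_integrable_B M (s n)"
    and slim: "(\<lambda>n. \<integral>\<^sup>+t. ennreal (norm (f t - s n t)) \<partial>M) \<longlonglongrightarrow> 0"
    and x: "(\<lambda>n. simple_integral_B M (s n)) \<longlonglongrightarrow> x"
    unfolding has_bochner_def by auto
  from g obtain r where gm: "g \<in> borel_measurable M"
    and r: "\<And>n. simple_integrable_B M (r n)"
    and rlim: "(\<lambda>n. \<integral>\<^sup>+t. ennreal (norm (g t - r n t)) \<partial>M) \<longlonglongrightarrow> 0"
    and y: "(\<lambda>n. simple_integral_B M (r n)) \<longlonglongrightarrow> y"
    unfolding has_bochner_def by auto
  show ?thesis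
    unfolding has_bochner_def
  proof (intro conjI exI allI m)
    show "simple_integrable_B M (\<lambda>t. s n t - r n t)" for n
      by (rule simple_bochner_integrable_compose2[OF _ s r]) simp
    show "(\<lambda>n. simple_integral_B M (\<lambda>t. s n t - r n t)) \<longlonglongrightarrow> x - y"
      by (subst simple_bochner_integral_diff[OF s r]) (rule tendsto_diff[OF x y])
    have "(\<integral>\<^sup>+t. ennreal (norm (f t - g t - (s n t - r n t))) \<partial>M)
        \<le> (\<integral>\<^sup>+t. ennreal (norm (f t - s n t)) \<partial>M) + (\<integral>\<^sup>+t. ennreal (norm (g t - r n t)) \<partial>M)" for n
    proof -
      have "(\<integral>\<^sup>+t. ennreal (norm (f t - g t - (s n t - r n t))) \<partial>M)
          \<le> (\<integral>\<^sup>+t. ennreal (norm (f t - s n t)) + ennreal (norm (g t - r n t)) \<partial>M)"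
      proof (intro nn_integral_mono)
        fix t
        have "f t - g t - (s n t - r n t) = (f t - s n t) - (g t - r n t)" by simp
        then have "norm (f t - g t - (s n t - r n t)) \<le> norm (f t - s n t) + norm (g t - r n t)"
          using norm_triangle_ineq4 by metis
        then show "ennreal (norm (f t - g t - (s n t - r n t)))
            \<le> ennreal (norm (f t - s n t)) + ennreal (norm (g t - r n t))"
          by (simp flip: ennreal_plus)
      qed
      also have "\<dots> = (\<integral>\<^sup>+t. ennreal (norm (f t - s n t)) \<partial>M) + (\<integral>\<^sup>+t. ennreal (norm (g t - r n t)) \<partial>M)"
        by (rule nn_integral_add[OF borel_measurable_norm_diff_simple[OF fm simple_integrable_B_simple[OF s]]
              borel_measurable_norm_diff_simple[OF gm simple_integrable_B_simple[OF r]]])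
      finally show ?thesis .
    qed
    then show "(\<lambda>n. \<integral>\<^sup>+t. ennreal (norm (f t - g t - (s n t - r n t))) \<partial>M) \<longlonglongrightarrow> 0"
      by (rule ennreal_tendsto_0_le[OF tendsto_add[OF slim rlim, unfolded add_0_left]])
  qed
qed

section \<open>Products with bounded real weights\<close>

lemma bounded_scaleR_approx:
  fixes m :: "'m \<Rightarrow> real"
  assumes m: "m \<in> borel_measurable M"
  obtains \<mu> where "\<And>n::nat. simple_function M (\<mu> n)" and "\<And>t. t \<in> space M \<Longrightarrow> (\<lambda>n. \<mu> n t) \<longlonglongrightarrow> m t"
    and "\<And>n t. t \<in> space M \<Longrightarrow> \<bar>\<mu> n t\<bar> \<le> 2 * \<bar>m t\<bar>"
proof -
  from borel_measurable_implies_sequence_metric[OF m, of 0] obtain \<mu>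
    where "\<forall>i. simple_function M (\<mu> i)" "\<forall>x\<in>space M. (\<lambda>i. \<mu> i x) \<longlonglongrightarrow> m x"
      "\<forall>i. \<forall>x\<in>space M. dist (\<mu> i x) 0 \<le> 2 * dist (m x) 0" by auto
  then show thesis by (intro that[of \<mu>]) (auto simp: dist_norm)
qed

text \<open>Only the real factor is approximated by simple functions, and multiplication by a simple
  function is covered by \<open>borel_measurable_combine_simple\<close>.\<close>

lemma borel_measurable_scaleR_nonseparable:
  fixes f :: "'m \<Rightarrow> 'x::real_normed_vector"
  assumes m: "m \<in> borel_measurable M" and f: "f \<in> borel_measurable M"
  shows "(\<lambda>t. m t *\<^sub>R f t) \<in> borel_measurable M"
proof -
  obtain \<mu> where \<mu>: "\<And>n::nat. simple_function M (\<mu> n)" "\<And>t. t \<in> space M \<Longrightarrow> (\<lambda>n. \<mu> n t) \<longlonglongrightarrow> m t"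
    using bounded_scaleR_approx[OF m] by metis
  show ?thesis
  proof (rule borel_measurable_LIMSEQ_metric)
    show "(\<lambda>t. \<mu> n t *\<^sub>R f t) \<in> borel_measurable M" for n
      by (rule borel_measurable_combine_simple[OF f \<mu>(1), of "(*\<^sub>R)"]) (intro continuous_intros)
    show "(\<lambda>n. \<mu> n t *\<^sub>R f t) \<longlonglongrightarrow> m t *\<^sub>R f t" if "t \<in> space M" for t
      by (intro tendsto_intros \<mu> that)
  qed
qed

lemma bochner_integrable_scaleR_bounded:
  fixes f :: "'m \<Rightarrow> 'x::banach"
  assumes m: "m \<in> borel_measurable M" and B: "\<And>t. t \<in> space M \<Longrightarrow> \<bar>m t\<bar> \<le> B"
    and f: "bochner_integrable M f"
  shows "bochner_integrable M (\<lambda>t. m t *\<^sub>R f t)"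
proof -
  from f obtain s where fm[measurable]: "f \<in> borel_measurable M"
    and s: "\<And>n. simple_integrable_B M (s n)"
    and slim: "(\<lambda>n. \<integral>\<^sup>+t. ennreal (norm (f t - s n t)) \<partial>M) \<longlonglongrightarrow> 0"
    unfolding has_bochner_def bochner_integrable_def by auto
  obtain \<mu> where \<mu>: "\<And>n::nat. simple_function M (\<mu> n)" "\<And>t. t \<in> space M \<Longrightarrow> (\<lambda>n. \<mu> n t) \<longlonglongrightarrow> m t"
    "\<And>n t. t \<in> space M \<Longrightarrow> \<bar>\<mu> n t\<bar> \<le> 2 * \<bar>m t\<bar>"
    using bounded_scaleR_approx[OF m] by metis
  note m[measurable]
  have [measurable]: "\<mu> n \<in> borel_measurable M" for n
    using \<mu>(1) by (rule borel_measurable_simple_function)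
  have [measurable]: "(\<lambda>t. ennreal (norm (f t - s n t))) \<in> borel_measurable M" for n
    by (rule borel_measurable_norm_diff_simple[OF fm simple_integrable_B_simple[OF s]])
  \<comment> \<open>\<open>B\<close> can be negative when the space is empty, hence the maximum with
    0.\<close>
  define B' where "B' = max 0 B"
  have B': "0 \<le> B'" "\<And>t. t \<in> space M \<Longrightarrow> \<bar>m t\<bar> \<le> B'" using B unfolding B'_def by force+
  have dct: "(\<lambda>n. \<integral>\<^sup>+t. ennreal (\<bar>m t - \<mu> n t\<bar> * norm (f t)) \<partial>M) \<longlonglongrightarrow> (\<integral>\<^sup>+t. 0 \<partial>M)"
  proof (rule nn_integral_dominated_convergence[where w = "\<lambda>t. ennreal (3 * B') * ennreal (norm (f t))"])
    show "(\<integral>\<^sup>+t. ennreal (3 * B') * ennreal (norm (f t)) \<partial>M) < \<infinity>"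
      using bochner_integrable_finite_norm[OF f] by (subst nn_integral_cmult) (auto simp: ennreal_mult_less_top)
    show "AE t in M. ennreal (\<bar>m t - \<mu> n t\<bar> * norm (f t)) \<le> ennreal (3 * B') * ennreal (norm (f t))" for n
    proof (intro AE_I2)
      fix t assume t: "t \<in> space M"
      have "\<bar>m t - \<mu> n t\<bar> \<le> 3 * B'" using \<mu>(3)[OF t, of n] B'(2)[OF t] by linarith
      then show "ennreal (\<bar>m t - \<mu> n t\<bar> * norm (f t)) \<le> ennreal (3 * B') * ennreal (norm (f t))"
        using B' by (simp add: mult_right_mono flip: ennreal_mult)
    qed
    show "AE t in M. (\<lambda>n. ennreal (\<bar>m t - \<mu> n t\<bar> * norm (f t))) \<longlonglongrightarrow> 0"
    proof (intro AE_I2)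
      fix t assume t: "t \<in> space M"
      have "(\<lambda>n. \<bar>m t - \<mu> n t\<bar> * norm (f t)) \<longlonglongrightarrow> \<bar>m t - m t\<bar> * norm (f t)"
        by (intro tendsto_intros \<mu>(2) t)
      then show "(\<lambda>n. ennreal (\<bar>m t - \<mu> n t\<bar> * norm (f t))) \<longlonglongrightarrow> 0"
        using tendsto_ennrealI by fastforce
    qed
  qed measurable
  \<comment> \<open>The product of the approximants errs by \<open>(m - \<mu> n) f\<close>, which
    dominated convergence controls, and by \<open>\<mu> n (f - s n)\<close>, where the weight is at
    most \<open>2 * B'\<close>.\<close>
  have le: "(\<integral>\<^sup>+t. ennreal (norm (m t *\<^sub>R f t - \<mu> n t *\<^sub>R s n t)) \<partial>M)
      \<le> (\<integral>\<^sup>+t. ennreal (\<bar>m t - \<mu> n t\<bar> * norm (f t)) \<partial>M)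
        + ennreal (2 * B') * (\<integral>\<^sup>+t. ennreal (norm (f t - s n t)) \<partial>M)" (is "?L n \<le> ?R n") for n
  proof -
    have "(\<integral>\<^sup>+t. ennreal (norm (m t *\<^sub>R f t - \<mu> n t *\<^sub>R s n t)) \<partial>M)
        \<le> (\<integral>\<^sup>+t. ennreal (\<bar>m t - \<mu> n t\<bar> * norm (f t)) + ennreal (2 * B') * ennreal (norm (f t - s n t)) \<partial>M)"
    proof (intro nn_integral_mono)
      fix t assume t: "t \<in> space M"
      have "m t *\<^sub>R f t - \<mu> n t *\<^sub>R s n t = (m t - \<mu> n t) *\<^sub>R f t + \<mu> n t *\<^sub>R (f t - s n t)"
        by (simp add: algebra_simps)
      then have "norm (m t *\<^sub>R f t - \<mu> n t *\<^sub>R s n t) \<le> \<bar>m t - \<mu> n t\<bar> * norm (f t) + \<bar>\<mu> n t\<bar> * norm (f t - s n t)"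
        by (metis norm_scaleR norm_triangle_ineq)
      also have "\<dots> \<le> \<bar>m t - \<mu> n t\<bar> * norm (f t) + 2 * B' * norm (f t - s n t)"
        using \<mu>(3)[OF t, of n] B'(2)[OF t] by (intro add_left_mono mult_right_mono) auto
      finally show "ennreal (norm (m t *\<^sub>R f t - \<mu> n t *\<^sub>R s n t))
          \<le> ennreal (\<bar>m t - \<mu> n t\<bar> * norm (f t)) + ennreal (2 * B') * ennreal (norm (f t - s n t))"
        using B' by (simp flip: ennreal_plus ennreal_mult)
    qed
    also have "\<dots> = ?R n"
      by (subst nn_integral_add, measurable) (subst nn_integral_cmult, measurable)
    finally show ?thesis .
  qed
  have "(\<lambda>n. ennreal (2 * B') * (\<integral>\<^sup>+t. ennreal (norm (f t - s n t)) \<partial>M)) \<longlonglongrightarrow> ennreal (2 * B') * 0"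
    by (rule ennreal_tendsto_cmult[OF _ slim]) simp
  from tendsto_add[OF dct this] have "?R \<longlonglongrightarrow> 0" by simp
  then have "?L \<longlonglongrightarrow> 0"
    by (rule ennreal_tendsto_0_le[OF _ le])
  then show ?thesis
  proof (rule bochner_integrableI_approx[rotated 2])
    show "(\<lambda>t. m t *\<^sub>R f t) \<in> borel_measurable M"
      by (rule borel_measurable_scaleR_nonseparable[OF m fm])
    fix n
    show "simple_integrable_B M (\<lambda>t. \<mu> n t *\<^sub>R s n t)"
    proof (rule simple_bochner_integrable.intros)
      show "simple_function M (\<lambda>t. \<mu> n t *\<^sub>R s n t)"
        by (rule simple_function_compose2[OF \<mu>(1) simple_integrable_B_simple[OF s]])
      have "emeasure M {t \<in> space M. \<mu> n t *\<^sub>R s n t \<noteq> 0} \<le> emeasure M {t \<in> space M. s n t \<noteq> 0}"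
        using simple_functionD(2)[OF simple_integrable_B_simple[OF s], of n "- {0}"]
        by (intro emeasure_mono) (auto simp: vimage_def Int_def conj_commute)
      then show "emeasure M {t \<in> space M. \<mu> n t *\<^sub>R s n t \<noteq> 0} \<noteq> \<infinity>"
        using s[of n] by (auto elim!: simple_bochner_integrable.cases simp: top_unique)
    qed
  qed
qed

definition weighted_integral :: "'m measure \<Rightarrow> ('m \<Rightarrow> 'x::real_normed_vector) \<Rightarrow> ('m \<Rightarrow> real) \<Rightarrow> 'x" where
  "weighted_integral M f m = bochner_integral M (\<lambda>t. m t *\<^sub>R f t)"

definition bounded_weight :: "'m measure \<Rightarrow> ('m \<Rightarrow> real) \<Rightarrow> bool" where
  "bounded_weight M m \<longleftrightarrow> m \<in> borel_measurable M \<and> (\<exists>B. \<forall>t\<in>space M. \<bar>m t\<bar> \<le> B)"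

lemma bounded_weightI:
  "m \<in> borel_measurable M \<Longrightarrow> (\<And>t. t \<in> space M \<Longrightarrow> \<bar>m t\<bar> \<le> B) \<Longrightarrow> bounded_weight M m"
  by (auto simp: bounded_weight_def)

lemma bounded_weight_indicator [simp]: "A \<in> sets M \<Longrightarrow> bounded_weight M (indicator A)"
  by (rule bounded_weightI[where B = 1]) (auto simp: indicator_def)

lemma bounded_weight_diff [simp]:
  assumes "bounded_weight M m" "bounded_weight M k"
  shows "bounded_weight M (\<lambda>t. m t - k t)"
proof -
  from assms obtain B C where "\<forall>t\<in>space M. \<bar>m t\<bar> \<le> B" "\<forall>t\<in>space M. \<bar>k t\<bar> \<le> C"
    unfolding bounded_weight_def by auto
  then have "\<bar>m t - k t\<bar> \<le> B + C" if "t \<in> space M" for t using that by (smt (verit))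
  then show ?thesis using assms
    by (intro bounded_weightI[where B = "B + C"]) (auto simp: bounded_weight_def)
qed

lemma bounded_weight_cmult [simp]:
  assumes "bounded_weight M m"
  shows "bounded_weight M (\<lambda>t. c * m t)"
proof -
  from assms obtain B where "\<forall>t\<in>space M. \<bar>m t\<bar> \<le> B"
    unfolding bounded_weight_def by auto
  then have "\<bar>c * m t\<bar> \<le> \<bar>c\<bar> * B" if "t \<in> space M" for t
    using that by (auto simp: abs_mult intro!: mult_left_mono)
  then show ?thesis using assms
    by (intro bounded_weightI[where B = "\<bar>c\<bar> * B"]) (auto simp: bounded_weight_def)
qed

context
  fixes M :: "'m measure" and f :: "'m \<Rightarrow> 'x::banach"
  assumes f: "bochner_integrable M f"
begin

lemma has_bochner_weighted:
  "bounded_weight M m \<Longrightarrow> has_bochner M (\<lambda>t. m t *\<^sub>R f t) (weighted_integral M f m)"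
  unfolding weighted_integral_def bounded_weight_def
  using bochner_integrable_scaleR_bounded[OF _ _ f] by (auto intro: has_bochner_bochner_integral)

lemma weighted_integral_norm_le:
  "ennreal (norm (weighted_integral M f m)) \<le> (\<integral>\<^sup>+t. ennreal (\<bar>m t\<bar> * norm (f t)) \<partial>M)"
  unfolding weighted_integral_def using bochner_integral_norm_le[of M "\<lambda>t. m t *\<^sub>R f t"] by simp

text \<open>\<open>has_bochner_diff\<close> asks for the measurability of the difference; it holds
  here because the difference is \<open>f\<close> times the single weight
  \<open>m - k\<close>.\<close>

lemma weighted_integral_diff:
  assumes "bounded_weight M m" "bounded_weight M k"
  shows "weighted_integral M f (\<lambda>t. m t - k t) = weighted_integral M f m - weighted_integral M f k"
proof -
  have "(\<lambda>t. (m t - k t) *\<^sub>R f t) \<in> borel_measurable M"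
    using has_bochner_weighted[OF bounded_weight_diff[OF assms]] by (rule has_bochner_measurable)
  with has_bochner_diff[OF assms[THEN has_bochner_weighted]]
  show ?thesis unfolding weighted_integral_def[of M f "\<lambda>t. m t - k t"]
    by (intro bochner_integral_eqI) (simp add: scaleR_diff_left)
qed

lemma weighted_integral_cmult:
  assumes "bounded_weight M m"
  shows "weighted_integral M f (\<lambda>t. c * m t) = c *\<^sub>R weighted_integral M f m"
  unfolding weighted_integral_def[of M f "\<lambda>t. c * m t"]
  using has_bochner_bounded_linear[OF bounded_linear_scaleR_right has_bochner_weighted[OF assms], of c]
  by (intro bochner_integral_eqI) simp

text \<open>Dominated convergence in the weight. It turns smooth weights into indicators in
  \<open>interval_mean_diff_le_derivative\<close> and finite unions into countable ones in
  \<open>AE_zero_if_initial_integrals_zero\<close>.\<close>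

lemma weighted_integral_tendsto:
  assumes m: "\<And>n. bounded_weight M (m n)" and k: "bounded_weight M k"
    and B: "\<And>n t. t \<in> space M \<Longrightarrow> \<bar>m n t\<bar> \<le> B"
    and lim: "\<And>t. t \<in> space M \<Longrightarrow> (\<lambda>n. m n t) \<longlonglongrightarrow> k t"
  shows "(\<lambda>n. weighted_integral M f (m n)) \<longlonglongrightarrow> weighted_integral M f k"
proof -
  have [measurable]: "f \<in> borel_measurable M" "m n \<in> borel_measurable M" "k \<in> borel_measurable M" for n
    using m k f by (auto simp: bounded_weight_def bochner_integrable_measurable)
  from k obtain C where C: "\<And>t. t \<in> space M \<Longrightarrow> \<bar>k t\<bar> \<le> C" unfolding bounded_weight_def by auto
  have "(\<lambda>n. \<integral>\<^sup>+t. ennreal (\<bar>m n t - k t\<bar> * norm (f t)) \<partial>M) \<longlonglongrightarrow> (\<integral>\<^sup>+t. 0 \<partial>M)"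
  proof (rule nn_integral_dominated_convergence[where w = "\<lambda>t. ennreal (B + C) * ennreal (norm (f t))"])
    show "(\<integral>\<^sup>+t. ennreal (B + C) * ennreal (norm (f t)) \<partial>M) < \<infinity>"
      using bochner_integrable_finite_norm[OF f] by (subst nn_integral_cmult) (auto simp: ennreal_mult_less_top)
    show "AE t in M. ennreal (\<bar>m n t - k t\<bar> * norm (f t)) \<le> ennreal (B + C) * ennreal (norm (f t))" for n
    proof (intro AE_I2)
      fix t assume t: "t \<in> space M"
      have le: "\<bar>m n t - k t\<bar> \<le> B + C" using B[OF t, of n] C[OF t] by linarith
      then have "0 \<le> B + C" by linarith
      then show "ennreal (\<bar>m n t - k t\<bar> * norm (f t)) \<le> ennreal (B + C) * ennreal (norm (f t))"
        using le by (simp add: mult_right_mono flip: ennreal_mult)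
    qed
    show "AE t in M. (\<lambda>n. ennreal (\<bar>m n t - k t\<bar> * norm (f t))) \<longlonglongrightarrow> 0"
    proof (intro AE_I2)
      fix t assume t: "t \<in> space M"
      have "(\<lambda>n. \<bar>m n t - k t\<bar> * norm (f t)) \<longlonglongrightarrow> \<bar>k t - k t\<bar> * norm (f t)"
        by (intro tendsto_intros lim t)
      then show "(\<lambda>n. ennreal (\<bar>m n t - k t\<bar> * norm (f t))) \<longlonglongrightarrow> 0"
        using tendsto_ennrealI by fastforce
    qed
  qed measurable
  then have "(\<lambda>n. weighted_integral M f (\<lambda>t. m n t - k t)) \<longlonglongrightarrow> 0"
    by (intro ennreal_norm_tendsto_0[OF weighted_integral_norm_le]) simp
  then have "(\<lambda>n. weighted_integral M f (m n) - weighted_integral M f k) \<longlonglongrightarrow> 0"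
    by (simp add: weighted_integral_diff m k)
  then show ?thesis by (simp add: LIM_zero_iff)
qed

end

lemma weighted_integral_AE_cong:
  fixes f :: "'m \<Rightarrow> 'x::banach"
  assumes f: "bochner_integrable M f" and m: "bounded_weight M m" and k: "bounded_weight M k"
    and eq: "AE t in M. m t = k t"
  shows "weighted_integral M f m = weighted_integral M f k"
proof -
  have "ennreal (norm (weighted_integral M f (\<lambda>t. m t - k t))) \<le> (\<integral>\<^sup>+t. ennreal (\<bar>m t - k t\<bar> * norm (f t)) \<partial>M)"
    by (rule weighted_integral_norm_le[OF f])
  also have "\<dots> = (\<integral>\<^sup>+t. 0 \<partial>M)"
    using eq by (intro nn_integral_cong_AE) (auto elim: eventually_mono)
  finally show ?thesis by (simp add: weighted_integral_diff[OF f m k])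
qed

text \<open>For a difference of functions, unlike one of weights, measurability is a genuine
  hypothesis; \<open>difference_measurable\<close> supplies it where this is applied.\<close>

lemma weighted_integral_minus_fun:
  fixes f g :: "'m \<Rightarrow> 'x::banach"
  assumes f: "bochner_integrable M f" and g: "bochner_integrable M g"
    and fg: "(\<lambda>t. f t - g t) \<in> borel_measurable M" and m: "bounded_weight M m"
  shows "weighted_integral M (\<lambda>t. f t - g t) m = weighted_integral M f m - weighted_integral M g m"
proof -
  have "(\<lambda>t. m t *\<^sub>R (f t - g t)) \<in> borel_measurable M"
    using m by (intro borel_measurable_scaleR_nonseparable fg) (simp add: bounded_weight_def)
  then have "has_bochner M (\<lambda>t. m t *\<^sub>R (f t - g t)) (weighted_integral M f m - weighted_integral M g m)"
    using has_bochner_diff[OF has_bochner_weighted[OF f m] has_bochner_weighted[OF g m]]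
    by (simp add: scaleR_diff_right)
  then show ?thesis by (simp add: weighted_integral_def[of M "\<lambda>t. f t - g t"] bochner_integral_eqI)
qed

section \<open>Restriction to subsets, and functions with vanishing set integrals\<close>

lemma has_bochner_restrict_space:
  fixes f :: "'m \<Rightarrow> 'x::banach"
  assumes f: "bochner_integrable M f" and A: "A \<in> sets M"
  shows "has_bochner (restrict_space M A) f (weighted_integral M f (indicator A))"
proof -
  have A': "A \<inter> space M \<in> sets M" using A by auto
  from f obtain s where fm: "f \<in> borel_measurable M"
    and s: "\<And>n. simple_integrable_B M (s n)"
    and lim: "(\<lambda>n. \<integral>\<^sup>+t. ennreal (norm (f t - s n t)) \<partial>M) \<longlonglongrightarrow> 0"
    unfolding has_bochner_def bochner_integrable_def by auto
  \<comment> \<open>The approximants times the indicator connect both sides: their integrals over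
    \<open>M\<close> tend to the weighted integral and equal the integrals of \<open>s n\<close>
    over the restricted space.\<close>
  have ind_s: "simple_integrable_B M (\<lambda>t. indicator A t *\<^sub>R s n t)" for n
  proof (rule simple_bochner_integrable.intros)
    show "simple_function M (\<lambda>t. indicator A t *\<^sub>R s n t)"
      by (rule simple_function_compose2[OF simple_function_indicator[OF A] simple_integrable_B_simple[OF s]])
    have "emeasure M {t \<in> space M. indicator A t *\<^sub>R s n t \<noteq> 0} \<le> emeasure M {t \<in> space M. s n t \<noteq> 0}"
      using simple_functionD(2)[OF simple_integrable_B_simple[OF s], of n "- {0}"]
      by (intro emeasure_mono) (auto simp: vimage_def Int_def conj_commute)
    then show "emeasure M {t \<in> space M. indicator A t *\<^sub>R s n t \<noteq> 0} \<noteq> \<infinity>"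
      using s[of n] by (auto elim!: simple_bochner_integrable.cases simp: top_unique)
  qed
  then have rs: "simple_integrable_B (restrict_space M A) (s n)" for n
    by (simp add: simple_bochner_integrable_restrict_space[OF A'])
  have "(\<integral>\<^sup>+t. ennreal (norm (indicator A t *\<^sub>R f t - indicator A t *\<^sub>R s n t)) \<partial>M)
      \<le> (\<integral>\<^sup>+t. ennreal (norm (f t - s n t)) \<partial>M)" for n
    by (intro nn_integral_mono) (auto simp: indicator_def)
  then have "(\<lambda>n. \<integral>\<^sup>+t. ennreal (norm (indicator A t *\<^sub>R f t - indicator A t *\<^sub>R s n t)) \<partial>M) \<longlonglongrightarrow> 0"
    by (rule ennreal_tendsto_0_le[OF lim])
  from has_bochner_approx_tendsto[OF has_bochner_weighted[OF f bounded_weight_indicator[OF A]] ind_s this]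
  have "(\<lambda>n. simple_integral_B (restrict_space M A) (s n)) \<longlonglongrightarrow> weighted_integral M f (indicator A)"
    by (simp add: simple_bochner_integral_restrict_space[OF A' rs])
  moreover have "(\<integral>\<^sup>+t. ennreal (norm (f t - s n t)) \<partial>restrict_space M A)
      \<le> (\<integral>\<^sup>+t. ennreal (norm (f t - s n t)) \<partial>M)" for n
    by (subst nn_integral_restrict_space[OF A']) (auto intro!: nn_integral_mono simp: indicator_def)
  then have "(\<lambda>n. \<integral>\<^sup>+t. ennreal (norm (f t - s n t)) \<partial>restrict_space M A) \<longlonglongrightarrow> 0"
    by (rule ennreal_tendsto_0_le[OF lim])
  ultimately show ?thesis
    unfolding has_bochner_def using rs measurable_restrict_space1[OF fm] by blast
qed

lemma has_bochner_const:
  assumes "emeasure M (space M) < \<infinity>"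
  shows "has_bochner M (\<lambda>_. c) (measure M (space M) *\<^sub>R c)"
proof -
  have "simple_integrable_B M (\<lambda>_. c)"
    using assms by (cases "c = 0") (auto intro!: simple_bochner_integrable.intros)
  moreover have "simple_integral_B M (\<lambda>_. c) = measure M (space M) *\<^sub>R c"
    by (cases "space M = {}") (auto simp: simple_bochner_integral_def image_constant_conv)
  ultimately show ?thesis using has_bochner_simple by metis
qed

lemma has_bochner_diff_const:
  assumes "emeasure M (space M) < \<infinity>" "has_bochner M f x"
  shows "has_bochner M (\<lambda>t. f t - c) (x - measure M (space M) *\<^sub>R c)"
  using assms by (intro has_bochner_diff has_bochner_const borel_measurable_diff_simple)
    (auto simp: has_bochner_measurable)

text \<open>If all set integrals of \<open>f\<close> vanish and \<open>s\<close> is simple, then on each level set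
  of \<open>s\<close> the mass of \<open>s\<close> is the norm of the integral of \<open>s - f\<close>.\<close>

lemma AE_zero_if_set_integrals_zero:
  fixes f :: "'m \<Rightarrow> 'x::banach"
  assumes f: "bochner_integrable M f"
    and zero: "\<And>A. A \<in> sets M \<Longrightarrow> weighted_integral M f (indicator A) = 0"
  shows "AE t in M. f t = 0"
proof -
  from f obtain s where fm[measurable]: "f \<in> borel_measurable M"
    and s: "\<And>n. simple_integrable_B M (s n)"
    and lim: "(\<lambda>n. \<integral>\<^sup>+t. ennreal (norm (f t - s n t)) \<partial>M) \<longlonglongrightarrow> 0"
    unfolding has_bochner_def bochner_integrable_def by auto
  have [measurable]: "(\<lambda>t. ennreal (norm (f t - s n t))) \<in> borel_measurable M" for n
    by (rule borel_measurable_norm_diff_simple[OF fm simple_integrable_B_simple[OF s]])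
  have mass: "(\<integral>\<^sup>+t. ennreal (norm (s n t)) \<partial>M) \<le> (\<integral>\<^sup>+t. ennreal (norm (f t - s n t)) \<partial>M)" for n
  proof -
    have sf: "simple_function M (s n)" by (rule simple_integrable_B_simple[OF s])
    define A where "A y = s n -` {y} \<inter> space M" for y
    have A[measurable]: "A y \<in> sets M" for y
      unfolding A_def by (rule simple_functionD(2)[OF sf])
    have fin: "finite (s n ` space M)" using sf by (rule simple_functionD(1))
    have "ennreal (norm y) * emeasure M (A y) \<le> (\<integral>\<^sup>+t. ennreal (norm (f t - s n t)) * indicator (A y) t \<partial>M)" for y
    proof (cases "y = 0")
      case False
      have Ay: "A y \<subseteq> {t \<in> space M. s n t \<noteq> 0}" using False by (auto simp: A_def)
      have "emeasure M {t \<in> space M. s n t \<noteq> 0} \<noteq> \<infinity>"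
        using s[of n] by (auto elim: simple_bochner_integrable.cases)
      moreover have "{t \<in> space M. s n t \<noteq> 0} \<in> sets M"
        using simple_functionD(2)[OF sf, of "- {0}"] by (simp add: vimage_def Int_def conj_commute)
      ultimately have fA: "emeasure M (A y) < \<infinity>"
        by (intro le_less_trans[OF emeasure_mono[OF Ay]]) (simp_all add: less_top)
      have rA: "space (restrict_space M (A y)) = A y"
        unfolding space_restrict_space A_def by auto
      have mA: "measure (restrict_space M (A y)) (A y) = measure M (A y)"
        using A[of y] by (subst measure_restrict_space) (auto simp: A_def)
      have eA: "emeasure (restrict_space M (A y)) (A y) = emeasure M (A y)"
        using A[of y] by (subst emeasure_restrict_space) (auto simp: A_def)
      have "has_bochner (restrict_space M (A y)) (\<lambda>t. f t - y) (0 - measure M (A y) *\<^sub>R y)"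
        using has_bochner_diff_const[OF _ has_bochner_restrict_space[OF f A], of y y] rA mA fA eA zero[OF A]
        by simp
      from has_bochner_norm_le[OF this]
      have "ennreal (measure M (A y) * norm y) \<le> (\<integral>\<^sup>+t. ennreal (norm (f t - y)) \<partial>restrict_space M (A y))"
        by simp
      also have "\<dots> = (\<integral>\<^sup>+t. ennreal (norm (f t - s n t)) * indicator (A y) t \<partial>M)"
        using A[of y] by (subst nn_integral_restrict_space) (auto intro!: nn_integral_cong simp: indicator_def A_def)
      finally show ?thesis
        using fA by (simp add: ennreal_mult mult.commute emeasure_eq_ennreal_measure)
    qed simp
    then have "(\<Sum>y\<in>s n ` space M. ennreal (norm y) * emeasure M (A y))
        \<le> (\<Sum>y\<in>s n ` space M. \<integral>\<^sup>+t. ennreal (norm (f t - s n t)) * indicator (A y) t \<partial>M)"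
      by (intro sum_mono)
    also have "\<dots> = (\<integral>\<^sup>+t. (\<Sum>y\<in>s n ` space M. ennreal (norm (f t - s n t)) * indicator (A y) t) \<partial>M)"
      by (subst nn_integral_sum) auto
    also have "\<dots> = (\<integral>\<^sup>+t. ennreal (norm (f t - s n t)) \<partial>M)"
    proof (intro nn_integral_cong)
      fix t assume t: "t \<in> space M"
      have "(\<Sum>y\<in>s n ` space M. ennreal (norm (f t - s n t)) * indicator (A y) t)
          = (\<Sum>y\<in>s n ` space M. if y = s n t then ennreal (norm (f t - s n t)) else 0)"
        using t by (intro sum.cong) (auto simp: A_def)
      then show "(\<Sum>y\<in>s n ` space M. ennreal (norm (f t - s n t)) * indicator (A y) t) = ennreal (norm (f t - s n t))"
        using t fin by (simp add: sum.delta)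
    qed
    also have "(\<Sum>y\<in>s n ` space M. ennreal (norm y) * emeasure M (A y)) = (\<integral>\<^sup>+t. ennreal (norm (s n t)) \<partial>M)"
    proof -
      have "(\<Sum>y\<in>s n ` space M. ennreal (norm y) * emeasure M (A y))
          = (\<integral>\<^sup>+t. (\<Sum>y\<in>s n ` space M. ennreal (norm y) * indicator (A y) t) \<partial>M)"
        by (subst nn_integral_sum) (auto simp: nn_integral_cmult_indicator)
      also have "\<dots> = (\<integral>\<^sup>+t. ennreal (norm (s n t)) \<partial>M)"
      proof (intro nn_integral_cong)
        fix t assume t: "t \<in> space M"
        have "(\<Sum>y\<in>s n ` space M. ennreal (norm y) * indicator (A y) t)
            = (\<Sum>y\<in>s n ` space M. if y = s n t then ennreal (norm (s n t)) else 0)"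
          using t by (intro sum.cong) (auto simp: A_def)
        then show "(\<Sum>y\<in>s n ` space M. ennreal (norm y) * indicator (A y) t) = ennreal (norm (s n t))"
          using t fin by (simp add: sum.delta)
      qed
      finally show ?thesis .
    qed
    finally show ?thesis .
  qed
  \<comment> \<open>As the mass of \<open>s n\<close> is at most the approximation error, that of
    \<open>f\<close> is at most twice the error, which tends to 0.\<close>
  have le: "(\<integral>\<^sup>+t. ennreal (norm (f t)) \<partial>M)
      \<le> (\<integral>\<^sup>+t. ennreal (norm (f t - s n t)) \<partial>M) + (\<integral>\<^sup>+t. ennreal (norm (f t - s n t)) \<partial>M)" for n
  proof -
    have "(\<integral>\<^sup>+t. ennreal (norm (f t)) \<partial>M)
        \<le> (\<integral>\<^sup>+t. ennreal (norm (f t - s n t)) + ennreal (norm (s n t)) \<partial>M)"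
      by (intro nn_integral_mono) (metis add.commute ennreal_leI ennreal_plus norm_ge_zero norm_triangle_sub)
    also have "\<dots> = (\<integral>\<^sup>+t. ennreal (norm (f t - s n t)) \<partial>M) + (\<integral>\<^sup>+t. ennreal (norm (s n t)) \<partial>M)"
      by (rule nn_integral_add[OF borel_measurable_norm_diff_simple[OF fm simple_integrable_B_simple[OF s]]
            borel_measurable_norm_simple[OF simple_integrable_B_simple[OF s]]])
    finally show ?thesis using mass[of n] by (meson add_left_mono order_trans)
  qed
  have "(\<integral>\<^sup>+t. ennreal (norm (f t)) \<partial>M) \<le> 0 + 0"
    by (rule LIMSEQ_le_const[OF tendsto_add[OF lim lim]]) (use le in auto)
  then have "AE t in M. ennreal (norm (f t)) = 0"
    by (subst (asm) add_0_left) (simp add: nn_integral_0_iff_AE)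
  then show ?thesis by simp
qed

section \<open>Smooth transition functions\<close>

text \<open>The case \<open>p = 1\<close> is the classical flat function; an arbitrary polynomial in
  \<open>1 / x\<close> as factor makes the family closed under differentiation.\<close>

definition flat_exp :: "real poly \<Rightarrow> real \<Rightarrow> real" where
  "flat_exp p x = (if 0 < x then poly p (1 / x) * exp (- 1 / x) else 0)"

lemma poly_times_exp_minus_tendsto_0: "((\<lambda>y::real. poly p y * exp (- y)) \<longlongrightarrow> 0) at_top"
proof -
  have "((\<lambda>y. \<Sum>i\<le>degree p. coeff p i * (y ^ i / exp y)) \<longlongrightarrow> (\<Sum>i\<le>degree p. coeff p i * 0)) at_top"
    by (intro tendsto_sum tendsto_mult tendsto_const tendsto_power_div_exp_0)
  moreover have "(\<lambda>y. \<Sum>i\<le>degree p. coeff p i * (y ^ i / exp y)) = (\<lambda>y. poly p y * exp (- y))"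
    by (simp add: fun_eq_iff poly_altdef sum_distrib_right exp_minus divide_inverse mult.assoc)
  ultimately show ?thesis by simp
qed

lemma flat_exp_tendsto_0: "(flat_exp p \<longlongrightarrow> 0) (at 0)"
proof -
  have "((\<lambda>x. poly p (inverse x) * exp (- inverse x)) \<longlongrightarrow> 0) (at_right (0::real))"
    by (rule filterlim_compose[OF poly_times_exp_minus_tendsto_0 filterlim_inverse_at_top_right])
  then have "(flat_exp p \<longlongrightarrow> 0) (at_right 0)"
    by (rule Lim_transform_eventually)
      (auto simp: eventually_at_right_less flat_exp_def inverse_eq_divide intro!: eventually_at_rightI[of 0 1])
  moreover have "(flat_exp p \<longlongrightarrow> 0) (at_left 0)"
    by (rule Lim_transform_eventually[OF tendsto_const])
      (auto simp: flat_exp_def intro!: eventually_at_leftI[of "-1"])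
  ultimately show ?thesis by (simp add: filterlim_at_split)
qed

text \<open>By the chain rule the derivative of \<open>p(1/x) exp(-1/x)\<close> is
  \<open>(p - p')(1/x) exp(-1/x) / x^2\<close>, and \<open>1 / x^2\<close> is the polynomial
  \<open>[:0, 0, 1:]\<close> at \<open>1 / x\<close>.\<close>

lemma flat_exp_deriv:
  "(flat_exp p has_real_derivative flat_exp ((p - pderiv p) * [:0, 0, 1:]) x) (at x)"
proof -
  consider "0 < x" | "x < 0" | "x = 0" by linarith
  then show ?thesis
  proof cases
    case 1
    have "((\<lambda>x. poly p (1 / x) * exp (- 1 / x)) has_real_derivative
        flat_exp ((p - pderiv p) * [:0, 0, 1:]) x) (at x)"
      using 1 by (auto intro!: derivative_eq_intros simp: flat_exp_def algebra_simps power2_eq_square divide_simps)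
    then show ?thesis
      by (rule has_field_derivative_transform_within_open[of _ _ _ "{0<..}"]) (use 1 in \<open>auto simp: flat_exp_def\<close>)
  next
    case 2
    have "((\<lambda>x. 0) has_real_derivative flat_exp ((p - pderiv p) * [:0, 0, 1:]) x) (at x)"
      using 2 by (auto simp: flat_exp_def)
    then show ?thesis
      by (rule has_field_derivative_transform_within_open[of _ _ _ "{..<0}"]) (use 2 in \<open>auto simp: flat_exp_def\<close>)
  next
    case 3
    \<comment> \<open>Division by \<open>h\<close> multiplies the polynomial by its variable, so the
      difference quotient at 0 is itself a flat function and tends to 0.\<close>
    have "((\<lambda>h. flat_exp (p * [:0, 1:]) h) \<longlongrightarrow> 0) (at 0)"
      by (rule flat_exp_tendsto_0)
    moreover have "flat_exp (p * [:0, 1:]) = (\<lambda>h. (flat_exp p (0 + h) - flat_exp p 0) / h)"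
      by (auto simp: flat_exp_def fun_eq_iff)
    ultimately show ?thesis
      using 3 by (simp add: DERIV_def) (simp add: flat_exp_def)
  qed
qed

text \<open>A class closed under differentiation, so that smoothness of all its members follows by
  induction on the order of the derivative. The affine arguments provide shifted, scaled and
  reflected copies.\<close>

inductive flat_exp_algebra :: "(real \<Rightarrow> real) \<Rightarrow> bool" where
  base: "flat_exp_algebra (\<lambda>x. flat_exp p (c * x + d))"
| const: "flat_exp_algebra (\<lambda>x. c)"
| add: "flat_exp_algebra f \<Longrightarrow> flat_exp_algebra g \<Longrightarrow> flat_exp_algebra (\<lambda>x. f x + g x)"
| mult: "flat_exp_algebra f \<Longrightarrow> flat_exp_algebra g \<Longrightarrow> flat_exp_algebra (\<lambda>x. f x * g x)"

lemma flat_exp_algebra_deriv: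
  "flat_exp_algebra f \<Longrightarrow> \<exists>g. flat_exp_algebra g \<and> (\<forall>x. (f has_real_derivative g x) (at x))"
proof (induction rule: flat_exp_algebra.induct)
  case (base p c d)
  have "((\<lambda>x. flat_exp p (c * x + d)) has_real_derivative
      flat_exp ((p - pderiv p) * [:0, 0, 1:]) (c * x + d) * c) (at x)" for x
    by (rule DERIV_chain'[OF _ flat_exp_deriv]) (auto intro!: derivative_eq_intros)
  then show ?case
    by (intro exI[of _ "\<lambda>x. flat_exp ((p - pderiv p) * [:0, 0, 1:]) (c * x + d) * c"])
      (intro conjI allI flat_exp_algebra.mult flat_exp_algebra.base flat_exp_algebra.const; assumption)
next
  case (const c)
  then show ?case by (intro exI[of _ "\<lambda>x. 0"]) (auto intro: flat_exp_algebra.intros)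
next
  case (add f g)
  then obtain f' g' where "flat_exp_algebra f'" "flat_exp_algebra g'"
    "\<And>x. (f has_real_derivative f' x) (at x)" "\<And>x. (g has_real_derivative g' x) (at x)" by blast
  then show ?case
    by (intro exI[of _ "\<lambda>x. f' x + g' x"]) (auto intro: flat_exp_algebra.intros DERIV_add)
next
  case (mult f g)
  then obtain f' g' where d: "flat_exp_algebra f'" "flat_exp_algebra g'"
    "\<And>x. (f has_real_derivative f' x) (at x)" "\<And>x. (g has_real_derivative g' x) (at x)" by blast
  have "flat_exp_algebra (\<lambda>x. f' x * g x + g' x * f x)"
    using mult.hyps d by (intro flat_exp_algebra.add flat_exp_algebra.mult)
  then show ?case
    using d(3,4) by (intro exI[of _ "\<lambda>x. f' x * g x + g' x * f x"]) (auto intro: DERIV_mult)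
qed

lemma flat_exp_algebra_continuous:
  assumes "flat_exp_algebra f"
  shows "continuous_on A f"
  using flat_exp_algebra_deriv[OF assms] by (meson DERIV_isCont continuous_at_imp_continuous_on)

lemma flat_exp_algebra_funpow_deriv:
  "flat_exp_algebra f \<Longrightarrow> flat_exp_algebra ((deriv ^^ n) f)"
proof (induction n)
  case (Suc n)
  then obtain g where "flat_exp_algebra g" "\<And>x. ((deriv ^^ n) f has_real_derivative g x) (at x)"
    using flat_exp_algebra_deriv by blast
  moreover from this have "deriv ((deriv ^^ n) f) = g"
    by (auto simp: fun_eq_iff intro: DERIV_imp_deriv)
  ultimately show ?case by simp
qed simp

text \<open>The transition functions are primitives of bumps; the derivative lies in the algebra by
  construction, while for the primitive itself this is not claimed.\<close>

lemma smooth_of_flat_exp_algebra_deriv: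
  assumes g: "flat_exp_algebra g" and f: "\<And>x. (f has_real_derivative g x) (at x)"
  shows "((deriv ^^ n) f) differentiable (at t)"
proof (cases n)
  case 0
  then show ?thesis using f by (auto simp: real_differentiable_def)
next
  case (Suc k)
  have "deriv f = g" using f by (auto simp: fun_eq_iff intro: DERIV_imp_deriv)
  then have "(deriv ^^ n) f = (deriv ^^ k) g" by (simp add: Suc funpow_swap1)
  then show ?thesis
    using flat_exp_algebra_deriv[OF flat_exp_algebra_funpow_deriv[OF g, of k]]
    by (auto simp: real_differentiable_def)
qed

text \<open>The bump \<open>exp (- 1 / (n (x - a) - 1)) exp (- 1 / (n (b - x) - 1))\<close> tends to \<open>1\<close> on \<open>(a, b)\<close>
  since its exponents tend to \<open>0\<close>.\<close>

lemma flat_exp_one_bounds: "0 \<le> flat_exp 1 x" "flat_exp 1 x \<le> 1"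
  by (auto simp: flat_exp_def)

lemma flat_exp_one_scaled_tendsto:
  assumes "0 < y"
  shows "(\<lambda>n. flat_exp 1 (real (Suc n) * y - 1)) \<longlonglongrightarrow> 1"
proof -
  have *: "filterlim (\<lambda>n. real (Suc n) * y - 1) at_top sequentially"
    using assms by real_asymp
  have "(\<lambda>n. exp (- inverse (real (Suc n) * y - 1))) \<longlonglongrightarrow> exp (- 0)"
    by (intro tendsto_intros filterlim_compose[OF tendsto_inverse_0_at_top *] tendsto_inverse_0_at_top *)
  moreover have "eventually (\<lambda>n. exp (- inverse (real (Suc n) * y - 1)) = flat_exp 1 (real (Suc n) * y - 1)) sequentially"
    using filterlim_at_top_dense[THEN iffD1, OF *, rule_format, of 0]
    by eventually_elim (auto simp: flat_exp_def inverse_eq_divide)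
  ultimately show ?thesis
    by (auto intro: Lim_transform_eventually)
qed

text \<open>\<open>G n\<close> is the normalized primitive of a bump on \<open>(a, b)\<close>.
  Paired with a function, its derivative \<open>\<psi> n\<close> yields in the limit the mean over
  \<open>(a, b)\<close>; the bound \<open>B\<close>, uniform in \<open>n\<close>, is there for
  dominated convergence, and the collars of width \<open>\<delta> n\<close> keep the supports of the
  later test functions inside the open interval.\<close>

lemma smooth_transition:
  fixes a b :: real
  assumes ab: "a < b"
  obtains G \<psi> :: "nat \<Rightarrow> real \<Rightarrow> real" and B :: real and \<delta> :: "nat \<Rightarrow> real"
  where "\<And>n. flat_exp_algebra (\<psi> n)"
    and "\<And>n x. (G n has_real_derivative \<psi> n x) (at x)"
    and "\<And>n. 0 < \<delta> n" and "\<And>n x. x \<le> a + \<delta> n \<Longrightarrow> G n x = 0" and "\<And>n x. b - \<delta> n \<le> x \<Longrightarrow> G n x = 1"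
    and "\<And>n x. 0 \<le> G n x" and "\<And>n x. G n x \<le> 1"
    and "\<And>n x. \<bar>\<psi> n x\<bar> \<le> B"
    and "\<And>x. (\<lambda>n. \<psi> n x) \<longlonglongrightarrow> indicator {a<..<b} x / (b - a)"
proof -
  \<comment> \<open>The shift by \<open>- 1\<close> in both arguments makes the bump vanish on
    collars of width \<open>1 / real (Suc n)\<close> inside the two ends.\<close>
  define e where "e n x = flat_exp 1 (real (Suc n) * (x - a) - 1) * flat_exp 1 (real (Suc n) * (b - x) - 1)"
    for n x
  have "e n = (\<lambda>x. flat_exp 1 (real (Suc n) * x + (- real (Suc n) * a - 1))
      * flat_exp 1 (- real (Suc n) * x + (real (Suc n) * b - 1)))" for n
    unfolding e_def by (intro ext arg_cong2[where f = "(*)"] arg_cong[where f = "flat_exp 1"])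
      (simp_all add: algebra_simps)
  then have alg: "flat_exp_algebra (e n)" for n
    using flat_exp_algebra.mult flat_exp_algebra.base by metis
  have e01: "0 \<le> e n x" "e n x \<le> 1" for n x
    unfolding e_def using flat_exp_one_bounds by (auto intro: mult_le_one)
  have e_left: "e n x = 0" if "x \<le> a + 1 / real (Suc n)" for n x
    using that unfolding e_def flat_exp_def by (auto simp: field_simps)
  have e_right: "e n x = 0" if "b - 1 / real (Suc n) \<le> x" for n x
    using that unfolding e_def flat_exp_def by (auto simp: field_simps)
  have e_lim: "(\<lambda>n. e n x) \<longlonglongrightarrow> indicator {a<..<b} x" for x
  proof (cases "x \<in> {a<..<b}")
    case True
    then have "(\<lambda>n. e n x) \<longlonglongrightarrow> 1 * 1"
      unfolding e_def by (intro tendsto_mult flat_exp_one_scaled_tendsto) auto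
    with True show ?thesis by simp
  next
    case False
    then have x: "x \<le> a \<or> b \<le> x" by auto
    have "e n x = 0" for n
    proof -
      have "0 \<le> 1 / real (Suc n)" by simp
      with x have "x \<le> a + 1 / real (Suc n) \<or> b - 1 / real (Suc n) \<le> x" by linarith
      then show ?thesis using e_left e_right by blast
    qed
    with False show ?thesis by simp
  qed
  have "\<exists>F. \<forall>x. (F has_real_derivative e n x) (at x)" for n
  proof -
    have "\<exists>F. \<forall>x. -\<infinity> < ereal x \<longrightarrow> ereal x < \<infinity> \<longrightarrow> (F has_vector_derivative e n x) (at x)"
      using flat_exp_algebra_continuous[OF alg, of UNIV n]
      by (intro einterval_antiderivative) (auto simp: continuous_on_eq_continuous_at)
    then show ?thesis by (auto simp: has_real_derivative_iff_has_vector_derivative)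
  qed
  then obtain F where F: "\<And>n x. (F n has_real_derivative e n x) (at x)" by metis
  have mono: "F n x \<le> F n y" if "x \<le> y" for n x y
    by (rule DERIV_nonneg_imp_nondecreasing[OF that]) (use F e01 in blast)
  have const: "F n x = F n y" if "x \<le> y" "\<And>z. x \<le> z \<Longrightarrow> z \<le> y \<Longrightarrow> e n z = 0" for n x y
  proof (cases "x = y")
    case False
    then have "F n y = F n x"
      using that by (intro DERIV_isconst_end)
        (auto intro!: continuous_at_imp_continuous_on DERIV_isCont[OF F] intro: F[of n, THEN DERIV_cong])
    then show ?thesis by simp
  qed simp
  define c where "c n = F n b - F n a" for n
  \<comment> \<open>The mass \<open>c n\<close> of the bump tends to the length
    \<open>b - a\<close>, which accounts for the normalization of the limit of
    \<open>\<psi> n\<close>.\<close>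
  have "(\<lambda>n. integral {a..b} (e n)) \<longlonglongrightarrow> integral {a..b} (indicator {a<..<b} :: real \<Rightarrow> real)"
  proof (rule dominated_convergence(2)[where h = "\<lambda>_. 1"])
    show "e n integrable_on {a..b}" for n
      by (intro integrable_continuous_interval flat_exp_algebra_continuous alg)
  qed (use e01 e_lim in \<open>auto simp: abs_of_nonneg\<close>)
  moreover have "integral {a..b} (e n) = c n" for n
    unfolding c_def using ab F
    by (intro integral_unique fundamental_theorem_of_calculus)
      (auto simp: has_real_derivative_iff_has_vector_derivative[symmetric] intro: has_field_derivative_at_within)
  moreover have "integral {a..b} (indicator {a<..<b} :: real \<Rightarrow> real) = b - a"
  proof -
    have "((\<lambda>_. 1::real) has_integral (b - a)) {a..b}"
      using has_integral_const_real[of "1::real" a b] ab by simp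
    then have "((indicator {a<..<b} :: real \<Rightarrow> real) has_integral (b - a)) {a..b}"
      by (rule has_integral_spike_finite[of "{a, b}", rotated 2]) auto
    then show ?thesis by (rule integral_unique)
  qed
  ultimately have c_lim: "c \<longlonglongrightarrow> b - a" by simp
  \<comment> \<open>From \<open>N0\<close> on the mass exceeds half its limit, whence the bound
    \<open>2 / (b - a)\<close>. The sequences are shifted by \<open>N0\<close> so that this holds
    for every index.\<close>
  from order_tendstoD(1)[OF c_lim, of "(b - a) / 2"] ab obtain N0 where N0: "\<And>n. N0 \<le> n \<Longrightarrow> (b - a) / 2 < c n"
    by (auto simp: eventually_sequentially)
  define \<psi> where "\<psi> n x = e (n + N0) x * (1 / c (n + N0))" for n x
  define G where "G n x = (F (n + N0) x - F (n + N0) a) * (1 / c (n + N0))" for n x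
  have c: "(b - a) / 2 < c (n + N0)" "0 < c (n + N0)" for n
    using N0[of "n + N0"] ab by auto
  show thesis
  proof (rule that[of \<psi> G "\<lambda>n. 1 / real (Suc (n + N0))" "2 / (b - a)"])
    show "flat_exp_algebra (\<psi> n)" for n
      unfolding \<psi>_def by (intro flat_exp_algebra.mult flat_exp_algebra.const) (rule alg)
    show "(G n has_real_derivative \<psi> n x) (at x)" for n x
      unfolding G_def \<psi>_def by (rule DERIV_cmult_right[OF DERIV_diff[OF F DERIV_const, unfolded diff_0_right]])
    have Fa: "F n x = F n a" if "x \<le> a + 1 / real (Suc n)" for n x
    proof (cases "x \<le> a")
      case True
      have "z \<le> a + 1 / real (Suc n)" if "z \<le> a" for z
        using that by (rule order_trans) simp
      with True show ?thesis by (intro const e_left)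
    next
      case False
      with that show ?thesis by (intro const[symmetric] e_left) auto
    qed
    have Fb: "F n x = F n b" if "b - 1 / real (Suc n) \<le> x" for n x
    proof (cases "b \<le> x")
      case True
      have "b - 1 / real (Suc n) \<le> z" if "b \<le> z" for z
        using that by (rule order_trans[rotated]) simp
      with True show ?thesis by (intro const[symmetric] e_right)
    next
      case False
      with that show ?thesis by (intro const e_right) auto
    qed
    show "G n x = 0" if "x \<le> a + 1 / real (Suc (n + N0))" for n x
      unfolding G_def using Fa[OF that] by simp
    show "G n x = 1" if "b - 1 / real (Suc (n + N0)) \<le> x" for n x
      unfolding G_def using Fb[OF that] c[of n] by (simp add: c_def)
    have Fab: "F n a \<le> F n x" "F n x \<le> F n b" for n x
    proof -
      have nn: "0 \<le> 1 / real (Suc n)" by simp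
      show "F n a \<le> F n x"
      proof (cases "a \<le> x")
        case False
        with nn have "x \<le> a + 1 / real (Suc n)" by linarith
        from Fa[OF this] show ?thesis by (rule eq_refl[OF sym])
      qed (rule mono)
      show "F n x \<le> F n b"
      proof (cases "x \<le> b")
        case False
        with nn have "b - 1 / real (Suc n) \<le> x" by linarith
        from Fb[OF this] show ?thesis by (rule eq_refl)
      qed (rule mono)
    qed
    show "0 \<le> G n x" "G n x \<le> 1" for n x
      unfolding G_def using Fab[of "n + N0" x] c[of n] by (auto simp: c_def)
    show "\<bar>\<psi> n x\<bar> \<le> 2 / (b - a)" for n x
    proof -
      have "e (n + N0) x * (1 / c (n + N0)) \<le> 1 * (2 / (b - a))"
        using c[of n] ab e01 by (intro mult_mono) (auto simp: field_simps)
      then show ?thesis unfolding \<psi>_def using e01 c[of n] by (simp add: abs_mult)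
    qed
    show "(\<lambda>n. \<psi> n x) \<longlonglongrightarrow> indicator {a<..<b} x / (b - a)" for x
    proof -
      have "(\<lambda>n. e n x * (1 / c n)) \<longlonglongrightarrow> indicator {a<..<b} x * (1 / (b - a))"
        using ab by (intro tendsto_intros e_lim c_lim) auto
      from LIMSEQ_ignore_initial_segment[OF this, of N0] show ?thesis
        unfolding \<psi>_def by simp
    qed
  qed simp
qed

section \<open>Means over intervals\<close>

lemma interval_sets_lebesgue: "{a<..<b::real} \<in> sets lebesgue"
  by (rule sets_completionI_sets) simp

lemma measurable_interval_lebesgue_on:
  "0 \<le> a \<Longrightarrow> b \<le> T \<Longrightarrow> {a<..<b} \<in> sets (lebesgue_on {0<..<T::real})"
  by (subst sets_restrict_space_iff) auto

lemma restrict_interval_lebesgue_on: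
  "0 \<le> a \<Longrightarrow> b \<le> T \<Longrightarrow> restrict_space (lebesgue_on {0<..<T::real}) {a<..<b} = lebesgue_on {a<..<b}"
  by (subst restrict_restrict_space) (auto intro!: arg_cong[where f = "restrict_space lebesgue"])

lemma has_bochner_interval:
  fixes f :: "real \<Rightarrow> 'x::banach"
  assumes "bochner_integrable (lebesgue_on {0<..<T}) f" and "0 \<le> a" and "b \<le> T"
  shows "has_bochner (lebesgue_on {a<..<b}) f (weighted_integral (lebesgue_on {0<..<T}) f (indicator {a<..<b}))"
  using has_bochner_restrict_space[OF assms(1) measurable_interval_lebesgue_on[OF assms(2,3)]]
  by (simp add: restrict_interval_lebesgue_on assms)

lemma interval_mean_weighted:
  fixes f :: "real \<Rightarrow> 'x::banach"
  assumes "bochner_integrable (lebesgue_on {0<..<T}) f" and "0 \<le> a" and "a < b" and "b \<le> T"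
  shows "interval_mean {a<..<b} f
    = (1 / (b - a)) *\<^sub>R weighted_integral (lebesgue_on {0<..<T}) f (indicator {a<..<b})"
  using bochner_integral_eqI[OF has_bochner_interval[OF assms(1,2,4)]] assms(3)
  by (simp add: interval_mean_def)

lemma has_bochner_interval_mean:
  fixes f :: "real \<Rightarrow> 'x::banach"
  assumes "bochner_integrable (lebesgue_on {0<..<T}) f" and "0 \<le> a" and "a < b" and "b \<le> T"
  shows "has_bochner (lebesgue_on {a<..<b}) f ((b - a) *\<^sub>R interval_mean {a<..<b} f)"
  using has_bochner_interval[OF assms(1,2,4)] assms(3) by (simp add: interval_mean_weighted[OF assms])

text \<open>With the embedding as \<open>L\<close>, a mean formed in the larger space is the image
  of one formed in the smaller space; this image is the second part of the splitting in the
  K-functional.\<close>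

lemma interval_mean_bounded_linear:
  fixes f :: "real \<Rightarrow> 'x::banach" and L :: "'x \<Rightarrow> 'y::banach"
  assumes "bounded_linear L" "bochner_integrable (lebesgue_on {0<..<T}) f" "0 \<le> a" "a < b" "b \<le> T"
  shows "interval_mean {a<..<b} (\<lambda>t. L (f t)) = L (interval_mean {a<..<b} f)"
proof -
  have "has_bochner (lebesgue_on {a<..<b}) (\<lambda>t. L (f t)) (L ((b - a) *\<^sub>R interval_mean {a<..<b} f))"
    by (rule has_bochner_bounded_linear[OF assms(1) has_bochner_interval_mean[OF assms(2-5)]])
  then show ?thesis
    using assms(4) by (simp add: interval_mean_def bochner_integral_eqI linear_simps(5)[OF assms(1)])
qed

text \<open>The constant is moved under the integral. With \<open>c\<close> the mean over a larger
  interval, an oscillation thereby bounds a difference of means.\<close>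

lemma norm_interval_mean_diff_le:
  fixes f :: "real \<Rightarrow> 'x::banach"
  assumes "bochner_integrable (lebesgue_on {0<..<T}) f" and "0 \<le> a" and "a < b" and "b \<le> T"
  shows "ennreal ((b - a) * norm (interval_mean {a<..<b} f - c)) \<le> (\<integral>\<^sup>+t\<in>{a<..<b}. ennreal (norm (f t - c)) \<partial>lebesgue)"
proof -
  let ?M = "lebesgue_on {a<..<b}"
  have m: "measure ?M (space ?M) = b - a" and e: "emeasure ?M (space ?M) < \<infinity>"
    using assms(3) by (auto simp: measure_restrict_space emeasure_restrict_space)
  have "has_bochner ?M (\<lambda>t. f t - c) ((b - a) *\<^sub>R interval_mean {a<..<b} f - measure ?M (space ?M) *\<^sub>R c)"
    by (rule has_bochner_diff_const[OF e has_bochner_interval_mean[OF assms]])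
  then have "has_bochner ?M (\<lambda>t. f t - c) ((b - a) *\<^sub>R (interval_mean {a<..<b} f - c))"
    unfolding m by (simp add: scaleR_diff_right)
  from has_bochner_norm_le[OF this] show ?thesis
    using assms(3) by (simp add: nn_integral_restrict_space)
qed

lemma continuous_imp_bounded_weight:
  fixes m :: "real \<Rightarrow> real"
  assumes "continuous_on UNIV m" and "\<And>t. \<bar>m t\<bar> \<le> B"
  shows "bounded_weight (lebesgue_on {0<..<T}) m"
  using assms by (intro bounded_weightI[where B = B] continuous_imp_measurable_on_sets_lebesgue)
    (auto intro: continuous_on_subset interval_sets_lebesgue)

text \<open>Test functions whose derivative approximates the difference of the normalized indicators
  of the two intervals; they are bounded by \<open>1\<close> and supported in the hull.\<close>

lemma interval_mean_diff_le_derivative: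
  fixes f w :: "real \<Rightarrow> 'x::banach"
  assumes f: "bochner_integrable (lebesgue_on {0<..<T}) f"
    and w: "bochner_integrable (lebesgue_on {0<..<T}) w"
    and fw: "distributional_derivative T f w"
    and pq: "0 \<le> p" "q \<le> T" and ab: "p \<le> a" "a < b" "b \<le> q" and cd: "p \<le> c" "c < d" "d \<le> q"
  shows "ennreal (norm (interval_mean {a<..<b} f - interval_mean {c<..<d} f))
    \<le> (\<integral>\<^sup>+t\<in>{p<..<q}. ennreal (norm (w t)) \<partial>lebesgue)"
proof -
  let ?M = "lebesgue_on {0<..<T}"
  obtain G1 \<psi>1 \<delta>1 B1 where 1: "\<And>n. flat_exp_algebra (\<psi>1 n)"
    "\<And>n x. (G1 n has_real_derivative \<psi>1 n x) (at x)" "\<And>n::nat. 0 < \<delta>1 n"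
    "\<And>n x. x \<le> a + \<delta>1 n \<Longrightarrow> G1 n x = 0" "\<And>n x. b - \<delta>1 n \<le> x \<Longrightarrow> G1 n x = 1"
    "\<And>n x. 0 \<le> G1 n x" "\<And>n x. G1 n x \<le> 1" "\<And>n x. \<bar>\<psi>1 n x\<bar> \<le> B1"
    "\<And>x. (\<lambda>n. \<psi>1 n x) \<longlonglongrightarrow> indicator {a<..<b} x / (b - a)"
    using smooth_transition[OF ab(2)] by metis
  obtain G2 \<psi>2 \<delta>2 B2 where 2: "\<And>n. flat_exp_algebra (\<psi>2 n)"
    "\<And>n x. (G2 n has_real_derivative \<psi>2 n x) (at x)" "\<And>n::nat. 0 < \<delta>2 n"
    "\<And>n x. x \<le> c + \<delta>2 n \<Longrightarrow> G2 n x = 0" "\<And>n x. d - \<delta>2 n \<le> x \<Longrightarrow> G2 n x = 1"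
    "\<And>n x. 0 \<le> G2 n x" "\<And>n x. G2 n x \<le> 1" "\<And>n x. \<bar>\<psi>2 n x\<bar> \<le> B2"
    "\<And>x. (\<lambda>n. \<psi>2 n x) \<longlonglongrightarrow> indicator {c<..<d} x / (d - c)"
    using smooth_transition[OF cd(2)] by metis
  \<comment> \<open>Both transitions rise from 0 to 1, so their difference lies between -1 and 1 and
    cancels to the right of both intervals.\<close>
  define \<phi> where "\<phi> n x = G1 n x - G2 n x" for n x
  define g where "g n x = \<psi>1 n x - \<psi>2 n x" for n x
  define \<kappa> where "\<kappa> x = 1 / (b - a) * indicator {a<..<b} x - 1 / (d - c) * indicator {c<..<d} x" for x :: real
  have deriv: "(\<phi> n has_real_derivative g n x) (at x)" for n x
    unfolding \<phi>_def g_def by (intro DERIV_diff 1 2)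
  have "flat_exp_algebra (\<lambda>x. \<psi>1 n x + (- 1) * \<psi>2 n x)" for n
    by (intro flat_exp_algebra.intros 1 2)
  then have g_alg: "flat_exp_algebra (g n)" for n
    by (simp add: g_def[abs_def])
  have \<phi>_zero: "\<phi> n x = 0" if "x \<notin> {p + min (\<delta>1 n) (\<delta>2 n)..q - min (\<delta>1 n) (\<delta>2 n)}" for n x
  proof -
    from that have "x < p + min (\<delta>1 n) (\<delta>2 n) \<or> q - min (\<delta>1 n) (\<delta>2 n) < x" by auto
    then show ?thesis
    proof
      assume "x < p + min (\<delta>1 n) (\<delta>2 n)"
      with ab cd have "x \<le> a + \<delta>1 n" "x \<le> c + \<delta>2 n" by linarith+
      then show ?thesis by (simp add: \<phi>_def 1 2)
    next
      assume "q - min (\<delta>1 n) (\<delta>2 n) < x"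
      with ab cd have "b - \<delta>1 n \<le> x" "d - \<delta>2 n \<le> x" by linarith+
      then show ?thesis by (simp add: \<phi>_def 1 2)
    qed
  qed
  have test: "test_function T (\<phi> n)" for n
    unfolding test_function_def
  proof (intro conjI allI)
    show "((deriv ^^ k) (\<phi> n)) differentiable (at t)" for k t
      by (rule smooth_of_flat_exp_algebra_deriv[OF g_alg deriv])
    have "closure {t. \<phi> n t \<noteq> 0} \<subseteq> {p + min (\<delta>1 n) (\<delta>2 n)..q - min (\<delta>1 n) (\<delta>2 n)}"
      using \<phi>_zero by (intro closure_minimal) blast+
    also have "\<dots> \<subseteq> {0<..<T}"
      using pq 1(3)[of n] 2(3)[of n] by auto
    finally show "closure {t. \<phi> n t \<noteq> 0} \<subseteq> {0<..<T}" .
  qed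
  have "deriv (\<phi> n) = g n" for n
    using deriv by (auto simp: fun_eq_iff intro: DERIV_imp_deriv)
  then have parts: "weighted_integral ?M f (g n) = - weighted_integral ?M w (\<phi> n)" for n
    using fw test unfolding distributional_derivative_def weighted_integral_def by metis
  have \<phi>_le: "\<bar>\<phi> n x\<bar> \<le> 1" for n x
    using 1(6,7)[of n x] 2(6,7)[of n x] unfolding \<phi>_def by linarith
  have g_le: "\<bar>g n x\<bar> \<le> B1 + B2" for n x
    using 1(8)[of n x] 2(8)[of n x] unfolding g_def by linarith
  have g_weight: "bounded_weight ?M (g n)" for n
    by (rule continuous_imp_bounded_weight[OF flat_exp_algebra_continuous[OF g_alg] g_le])
  have J: "{a<..<b} \<in> sets ?M" "{c<..<d} \<in> sets ?M"
    using pq ab cd by (auto intro!: measurable_interval_lebesgue_on)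
  have \<kappa>_weight: "bounded_weight ?M \<kappa>"
    unfolding \<kappa>_def[abs_def]
    by (intro bounded_weight_diff bounded_weight_cmult bounded_weight_indicator J)
  have "(\<lambda>n. g n x) \<longlonglongrightarrow> \<kappa> x" for x
    using tendsto_diff[OF 1(9)[of x] 2(9)[of x]] by (simp add: g_def \<kappa>_def)
  then have "(\<lambda>n. weighted_integral ?M f (g n)) \<longlonglongrightarrow> weighted_integral ?M f \<kappa>"
    using g_le by (intro weighted_integral_tendsto[OF f g_weight \<kappa>_weight])
  moreover have "weighted_integral ?M f \<kappa> = interval_mean {a<..<b} f - interval_mean {c<..<d} f"
    unfolding \<kappa>_def[abs_def] using J pq ab cd
    by (simp add: weighted_integral_diff[OF f] weighted_integral_cmult[OF f] interval_mean_weighted[OF f]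
        del: times_divide_eq_left mult_1)
  ultimately have lim: "(\<lambda>n. ennreal (norm (weighted_integral ?M f (g n))))
      \<longlonglongrightarrow> ennreal (norm (interval_mean {a<..<b} f - interval_mean {c<..<d} f))"
    by (intro tendsto_ennrealI tendsto_norm) simp
  have le: "ennreal (norm (weighted_integral ?M f (g n)))
      \<le> (\<integral>\<^sup>+t\<in>{p<..<q}. ennreal (norm (w t)) \<partial>lebesgue)" for n
  proof -
    have "ennreal (norm (weighted_integral ?M f (g n))) \<le> (\<integral>\<^sup>+t. ennreal (\<bar>\<phi> n t\<bar> * norm (w t)) \<partial>?M)"
      using weighted_integral_norm_le[OF w] by (simp add: parts)
    also have "\<dots> = (\<integral>\<^sup>+t\<in>{0<..<T}. ennreal (\<bar>\<phi> n t\<bar> * norm (w t)) \<partial>lebesgue)"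
      by (simp add: nn_integral_restrict_space)
    also have "\<dots> \<le> (\<integral>\<^sup>+t\<in>{p<..<q}. ennreal (norm (w t)) \<partial>lebesgue)"
    proof (intro nn_integral_mono)
      fix t
      show "ennreal (\<bar>\<phi> n t\<bar> * norm (w t)) * indicator {0<..<T} t \<le> ennreal (norm (w t)) * indicator {p<..<q} t"
      proof (cases "t \<in> {p<..<q}")
        case True
        then show ?thesis
          using \<phi>_le[of n t] by (auto simp: indicator_def intro!: ennreal_leI mult_left_le_one_le)
      next
        case False
        then have "\<phi> n t = 0"
          using 1(3)[of n] 2(3)[of n] by (intro \<phi>_zero) auto
        then show ?thesis by simp
      qed
    qed
    finally show ?thesis .
  qed
  show ?thesis
    by (rule LIMSEQ_le_const2[OF lim]) (use le in blast)
qed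

section \<open>Logarithmic growth of the means of a BMO function\<close>

lemma interval_extension:
  fixes a b L T :: real
  assumes "0 \<le> a" "a \<le> b" "b \<le> T" "b - a \<le> L" "L \<le> T"
  obtains a' where "0 \<le> a'" "a' \<le> a" "b \<le> a' + L" "a' + L \<le> T"
  \<comment> \<open>The right end is kept unless the longer interval would then begin left of
    0.\<close>
  using assms by (intro that[of "max 0 (b - L)"]) auto

context
  fixes T :: real and g :: "real \<Rightarrow> 'x::banach"
  assumes T: "0 < T" and g: "g \<in> BMO_star T"
begin

lemma BMO_star_integrable: "bochner_integrable (lebesgue_on {0<..<T}) g"
  using g by (simp add: BMO_star_def)

lemma BMO_star_norm_eq: "BMO_star_norm T g = ennreal (enn2real (BMO_star_norm T g))"
  using g by (simp add: BMO_star_def)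

lemma BMO_star_norm_real:
  "enn2real (BMO_star_norm T g) = norm (interval_mean {0<..<T} g) + enn2real (BMO_seminorm T g)"
  using g by (simp add: BMO_star_def BMO_star_norm_def enn2real_plus)

lemma BMO_oscillation_le:
  assumes "0 \<le> a" "a < b" "b \<le> T"
  shows "(\<integral>\<^sup>+t\<in>{a<..<b}. ennreal (norm (g t - interval_mean {a<..<b} g)) \<partial>lebesgue)
    \<le> ennreal (enn2real (BMO_seminorm T g) * (b - a))" (is "?L \<le> _")
proof -
  have fin: "BMO_seminorm T g = ennreal (enn2real (BMO_seminorm T g))"
    using g by (auto simp: BMO_star_def BMO_star_norm_def)
  have "(\<integral>\<^sup>+t. ennreal (norm (g t - interval_mean {a<..<b} g)) \<partial>lebesgue_on {a<..<b})
      / ennreal (measure lebesgue {a<..<b}) \<le> BMO_seminorm T g"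
    unfolding BMO_seminorm_def using assms by (intro SUP_upper) (auto simp: is_interval_def)
  then have "?L / ennreal (b - a) \<le> ennreal (enn2real (BMO_seminorm T g))"
    using assms fin by (simp add: nn_integral_restrict_space)
  then have "?L / ennreal (b - a) * ennreal (b - a) \<le> ennreal (enn2real (BMO_seminorm T g)) * ennreal (b - a)"
    by (rule mult_right_mono) simp
  moreover have "?L / ennreal (b - a) * ennreal (b - a) = ?L"
    using assms by (intro ennreal_divide_times[THEN trans] mult_divide_eq_ennreal) auto
  ultimately show ?thesis
    using assms by (simp add: ennreal_mult)
qed

text \<open>The oscillation around the larger mean, integrated over the larger interval, dominates
  the same integral over the smaller one; dividing by the smaller length costs the ratio of the
  lengths, at most 2.\<close>

lemma BMO_mean_diff_le:
  assumes "0 \<le> a'" "a' \<le> a" "a < b" "b \<le> b'" "b' \<le> T" "b' - a' \<le> 2 * (b - a)"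
  shows "norm (interval_mean {a<..<b} g - interval_mean {a'<..<b'} g) \<le> 2 * enn2real (BMO_seminorm T g)"
proof -
  let ?c = "interval_mean {a'<..<b'} g"
  have "ennreal ((b - a) * norm (interval_mean {a<..<b} g - ?c))
      \<le> (\<integral>\<^sup>+t\<in>{a<..<b}. ennreal (norm (g t - ?c)) \<partial>lebesgue)"
    using assms by (intro norm_interval_mean_diff_le[OF BMO_star_integrable]) auto
  also have "\<dots> \<le> (\<integral>\<^sup>+t\<in>{a'<..<b'}. ennreal (norm (g t - ?c)) \<partial>lebesgue)"
    using assms by (intro nn_integral_mono) (auto simp: indicator_def)
  also have "\<dots> \<le> ennreal (enn2real (BMO_seminorm T g) * (b' - a'))"
    using assms by (intro BMO_oscillation_le) auto
  finally have "(b - a) * norm (interval_mean {a<..<b} g - ?c) \<le> enn2real (BMO_seminorm T g) * (b' - a')"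
    using assms by (subst (asm) ennreal_le_iff) auto
  also have "\<dots> \<le> (b - a) * (2 * enn2real (BMO_seminorm T g))"
    using mult_left_mono[OF assms(6), of "enn2real (BMO_seminorm T g)"] by (simp add: algebra_simps)
  finally show ?thesis
    using assms(3) by simp
qed

text \<open>The induction runs over arbitrary intervals, not over a dyadic grid: one shorter than
  \<open>T / 2 ^ k\<close> is enlarged inside \<open>(0, T)\<close> to exactly this length, which at
  most doubles it. For \<open>k = 0\<close> the interval is \<open>(0, T)\<close>, whose mean is
  part of the starred norm.\<close>

lemma BMO_mean_le:
  assumes "0 \<le> a" "a < b" "b \<le> T" "T / 2 ^ k \<le> b - a"
  shows "norm (interval_mean {a<..<b} g) \<le> (1 + 2 * real k) * enn2real (BMO_star_norm T g)"
  using assms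
proof (induction k arbitrary: a b)
  case 0
  then have "a = 0" "b = T" by auto
  then show ?case by (simp add: BMO_star_norm_real)
next
  case (Suc k)
  show ?case
  proof (cases "T / 2 ^ k \<le> b - a")
    case True
    have "norm (interval_mean {a<..<b} g) \<le> (1 + 2 * real k) * enn2real (BMO_star_norm T g)"
      using Suc True by blast
    also have "\<dots> \<le> (1 + 2 * real (Suc k)) * enn2real (BMO_star_norm T g)"
      by (intro mult_right_mono) auto
    finally show ?thesis .
  next
    case False
    have "T / 2 ^ k \<le> T" using T by (simp add: field_simps)
    with Suc.prems False obtain a' where a': "0 \<le> a'" "a' \<le> a" "b \<le> a' + T / 2 ^ k" "a' + T / 2 ^ k \<le> T"
      using interval_extension[of a b T "T / 2 ^ k"] by auto
    have "norm (interval_mean {a<..<b} g - interval_mean {a'<..<a' + T / 2 ^ k} g) \<le> 2 * enn2real (BMO_seminorm T g)"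
      using a' Suc.prems by (intro BMO_mean_diff_le) (auto simp: field_simps)
    moreover have "norm (interval_mean {a'<..<a' + T / 2 ^ k} g) \<le> (1 + 2 * real k) * enn2real (BMO_star_norm T g)"
      using a' T by (intro Suc.IH) auto
    moreover have "enn2real (BMO_seminorm T g) \<le> enn2real (BMO_star_norm T g)"
      by (simp add: BMO_star_norm_real)
    ultimately have "norm (interval_mean {a<..<b} g)
        \<le> 2 * enn2real (BMO_star_norm T g) + (1 + 2 * real k) * enn2real (BMO_star_norm T g)"
      using norm_triangle_sub[of "interval_mean {a<..<b} g" "interval_mean {a'<..<a' + T / 2 ^ k} g"] by linarith
    then show ?thesis by (simp add: algebra_simps)
  qed
qed

text \<open>The interval may be arbitrarily short, where means are badly controlled, so it is first
  enlarged to length \<open>T / 2 ^ k\<close>. The factor \<open>2 + 2 * real k\<close> is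
  \<open>1 + 2 * real k\<close> for the mean and 1 for the oscillation.\<close>

lemma BMO_integral_le:
  assumes "0 \<le> a" "a \<le> b" "b \<le> T" "b - a \<le> T / 2 ^ k"
  shows "(\<integral>\<^sup>+t\<in>{a<..<b}. ennreal (norm (g t)) \<partial>lebesgue)
    \<le> ennreal (T / 2 ^ k * ((2 + 2 * real k) * enn2real (BMO_star_norm T g)))"
proof -
  define L where "L = T / 2 ^ k"
  have L: "L \<le> T" "0 < L" using T by (auto simp: L_def field_simps)
  obtain a' where a': "0 \<le> a'" "a' \<le> a" "b \<le> a' + L" "a' + L \<le> T"
    using interval_extension[of a b T L] L assms by (auto simp: L_def)
  let ?J = "{a'<..<a' + L}" let ?c = "interval_mean ?J g" let ?N = "enn2real (BMO_star_norm T g)"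
  have c: "norm ?c \<le> (1 + 2 * real k) * ?N"
    using a' L by (intro BMO_mean_le) (auto simp: L_def)
  have m: "(\<lambda>t. ennreal (norm (g t - ?c)) * indicator ?J t) \<in> borel_measurable lebesgue"
  proof -
    have "(\<lambda>t. g t - ?c) \<in> borel_measurable (lebesgue_on ?J)"
      using has_bochner_measurable[OF has_bochner_interval_mean[OF BMO_star_integrable a'(1) _ a'(4)]] L
      by (intro borel_measurable_diff_simple) auto
    then have "(\<lambda>t. norm (g t - ?c)) \<in> borel_measurable (lebesgue_on ?J)"
      by (rule measurable_compose) simp
    then have "(\<lambda>t. ennreal (norm (g t - ?c))) \<in> borel_measurable (lebesgue_on ?J)"
      by simp
    then show ?thesis
      by (subst (asm) borel_measurable_restrict_space_iff_ennreal) auto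
  qed
  have "(\<integral>\<^sup>+t\<in>{a<..<b}. ennreal (norm (g t)) \<partial>lebesgue)
      \<le> (\<integral>\<^sup>+t. ennreal (norm (g t - ?c)) * indicator ?J t + ennreal (norm ?c) * indicator ?J t \<partial>lebesgue)"
  proof (intro nn_integral_mono)
    fix t
    have "ennreal (norm (g t)) \<le> ennreal (norm (g t - ?c)) + ennreal (norm ?c)"
      by (metis add.commute ennreal_leI ennreal_plus norm_ge_zero norm_triangle_sub)
    then show "ennreal (norm (g t)) * indicator {a<..<b} t
        \<le> ennreal (norm (g t - ?c)) * indicator ?J t + ennreal (norm ?c) * indicator ?J t"
      using a' by (auto simp: indicator_def)
  qed
  also have "\<dots> = (\<integral>\<^sup>+t. ennreal (norm (g t - ?c)) * indicator ?J t \<partial>lebesgue)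
      + (\<integral>\<^sup>+t. ennreal (norm ?c) * indicator ?J t \<partial>lebesgue)"
    by (rule nn_integral_add[OF m]) (auto intro!: borel_measurable_times_ennreal borel_measurable_indicator sets_completionI_sets)
  also have "(\<integral>\<^sup>+t. ennreal (norm ?c) * indicator ?J t \<partial>lebesgue) = ennreal (norm ?c * L)"
    using L by (subst nn_integral_cmult_indicator) (auto simp: ennreal_mult)
  also have "(\<integral>\<^sup>+t. ennreal (norm (g t - ?c)) * indicator ?J t \<partial>lebesgue) + ennreal (norm ?c * L)
      \<le> ennreal (enn2real (BMO_seminorm T g) * L) + ennreal (norm ?c * L)"
    using BMO_oscillation_le[of a' "a' + L"] a' L by (intro add_right_mono) auto
  also have "\<dots> = ennreal ((enn2real (BMO_seminorm T g) + norm ?c) * L)"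
    using L by (simp add: distrib_right flip: ennreal_plus)
  also have "\<dots> \<le> ennreal (L * ((2 + 2 * real k) * ?N))"
  proof (intro ennreal_leI)
    have "enn2real (BMO_seminorm T g) + norm ?c \<le> (2 + 2 * real k) * ?N"
    proof -
      have "enn2real (BMO_seminorm T g) \<le> ?N" by (simp add: BMO_star_norm_real)
      moreover have "(2 + 2 * real k) * ?N = ?N + (1 + 2 * real k) * ?N" by (simp add: algebra_simps)
      ultimately show ?thesis using c by linarith
    qed
    then show "(enn2real (BMO_seminorm T g) + norm ?c) * L \<le> L * ((2 + 2 * real k) * ?N)"
      using L by (simp add: mult.commute)
  qed
  finally show ?thesis by (simp add: L_def)
qed

end

section \<open>The continuous representative\<close>

text \<open>Half-lines are stable under intersection and generate the Borel sets, so a Dynkin class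
  argument carries the vanishing to all Borel sets, and null sets then give all Lebesgue
  sets.\<close>

lemma AE_zero_if_initial_integrals_zero:
  fixes f :: "real \<Rightarrow> 'x::banach"
  assumes T: "0 < T" and f: "bochner_integrable (lebesgue_on {0<..<T}) f"
    and zero: "\<And>x. 0 \<le> x \<Longrightarrow> x \<le> T \<Longrightarrow> weighted_integral (lebesgue_on {0<..<T}) f (indicator {0<..<x}) = 0"
  shows "AE t in lebesgue_on {0<..<T}. f t = 0"
proof (rule AE_zero_if_set_integrals_zero[OF f])
  let ?M = "lebesgue_on {0<..<T}"
  let ?I = "weighted_integral ?M f"
  have weight: "bounded_weight ?M (indicator A)" if "A \<in> sets borel" for A
  proof (rule bounded_weightI[where B = 1])
    have "indicator A \<in> borel_measurable lebesgue"
      using that by (intro borel_measurable_indicator sets_completionI_sets) simp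
    then show "indicator A \<in> borel_measurable ?M"
      by (rule measurable_restrict_space1)
  qed (auto simp: indicator_def)
  have cong: "?I m = ?I k" if "bounded_weight ?M m" "bounded_weight ?M k" "\<And>t. 0 < t \<Longrightarrow> t < T \<Longrightarrow> m t = k t" for m k
    using that by (intro weighted_integral_AE_cong[OF f] AE_I2) auto
  have borel: "(borel :: real measure) = sigma UNIV (range lessThan)"
    unfolding borel_eq_lessThan[where 'a = real] by (simp add: eucl_less_def lessThan_def[abs_def] eucl_less_def)
  have zero_borel: "?I (indicator A) = 0" if "A \<in> sets borel" for A
  proof -
    have A: "A \<in> sigma_sets UNIV (range lessThan)"
      using that by (subst (asm) borel) simp
    have "Int_stable (range (lessThan :: real \<Rightarrow> real set))"
    proof (rule Int_stableI)
      fix A B :: "real set" assume "A \<in> range lessThan" "B \<in> range lessThan"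
      then obtain a b where "A = {..<a}" "B = {..<b}" by auto
      then show "A \<inter> B \<in> range lessThan" by (intro range_eqI[of _ _ "min a b"]) auto
    qed
    moreover have "range (lessThan :: real \<Rightarrow> real set) \<subseteq> Pow UNIV" by simp
    ultimately show ?thesis
      using A
    proof (induction A rule: sigma_sets_induct_disjoint)
      case (basic A)
      then obtain x where A: "A = {..<x}" by auto
      \<comment> \<open>On \<open>(0, T)\<close> the half-line agrees with an initial interval whose
        end is \<open>x\<close> clamped to \<open>[0, T]\<close>.\<close>
      have "?I (indicator A) = ?I (indicator {0<..<max 0 (min x T)})"
        unfolding A by (intro cong weight) (auto simp: indicator_def)
      also have "\<dots> = 0" using T by (intro zero) auto
      finally show ?case .
    next
      case empty
      have "?I (indicator {}) = ?I (indicator {0<..<0})"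
        by (intro cong weight) (auto simp: indicator_def)
      also have "\<dots> = 0" using T by (intro zero) auto
      finally show ?case .
    next
      case (compl A)
      then have A: "A \<in> sets borel" by (subst borel) simp
      have "?I (indicator (UNIV - A)) = ?I (\<lambda>t. indicator {0<..<T} t - indicator A t)"
        using A by (intro cong bounded_weight_diff weight) (auto simp: indicator_def)
      also have "\<dots> = ?I (indicator {0<..<T}) - ?I (indicator A)"
        using A by (intro weighted_integral_diff[OF f] weight) auto
      also have "\<dots> = 0" using compl zero[of T] T by simp
      finally show ?case .
    next
      case (union A)
      have A: "A i \<in> sets borel" for i using union by (subst borel) auto
      have "?I (indicator (\<Union>i<n. A i)) = 0" for n
      proof (induction n)
        case 0
        have "?I (indicator {}) = ?I (indicator {0<..<0})"
          by (intro cong weight) (auto simp: indicator_def)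
        also have "\<dots> = 0" using T by (intro zero) auto
        finally show ?case by (simp only: lessThan_0 UN_empty)
      next
        case (Suc n)
        have disj: "t \<notin> A n" if "t \<in> A i" "i < n" for t i
          using that disjoint_family_onD[OF \<open>disjoint_family A\<close>, of i n] by auto
        have U: "(\<Union>i<n. A i) \<in> sets borel" using A by auto
        \<comment> \<open>The sum of two indicators is written as a difference with factor -1 to fit
          \<open>weighted_integral_diff\<close>.\<close>
        have "?I (indicator (\<Union>i<Suc n. A i)) = ?I (\<lambda>t. indicator (\<Union>i<n. A i) t - (- 1) * indicator (A n) t)"
          using A U disj by (intro cong bounded_weight_diff bounded_weight_cmult weight)
            (auto simp: indicator_def less_Suc_eq)
        also have "\<dots> = ?I (indicator (\<Union>i<n. A i)) - ?I (\<lambda>t. (- 1) * indicator (A n) t)"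
          by (intro weighted_integral_diff[OF f] bounded_weight_cmult weight A U)
        also have "\<dots> = ?I (indicator (\<Union>i<n. A i)) - (- 1) *\<^sub>R ?I (indicator (A n))"
          by (simp only: weighted_integral_cmult[OF f weight[OF A]])
        also have "\<dots> = 0" using Suc union.IH by simp
        finally show ?case .
      qed
      moreover have "(\<lambda>n. ?I (indicator (\<Union>i<n. A i))) \<longlonglongrightarrow> ?I (indicator (\<Union>i. A i))"
        using A by (intro weighted_integral_tendsto[OF f, where B = 1] weight LIMSEQ_indicator_UN)
          (auto simp: indicator_def)
      ultimately show ?case by (simp add: LIMSEQ_const_iff)
    qed
  qed
  fix A assume A: "A \<in> sets ?M"
  then have "A \<in> sets lebesgue"
    using interval_sets_lebesgue[of 0 T] by (auto simp: sets_restrict_space_iff)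
  \<comment> \<open>A Lebesgue set is an F-sigma set up to a null set, which leaves the weighted
    integral unchanged.\<close>
  then obtain C N where C: "fsigma C" "N \<in> null_sets lebesgue" "C \<union> N = A" "disjnt C N"
    using lebesgue_set_almost_fsigma by metis
  have "C \<in> sets borel"
    using C(1) by (induction) (auto intro: borel_closed)
  moreover have "?I (indicator A) = ?I (indicator C)"
  proof (rule weighted_integral_AE_cong[OF f bounded_weight_indicator[OF A] weight])
    show "C \<in> sets borel" by fact
    have "AE t in lebesgue. t \<notin> N" using C(2) by (rule AE_not_in)
    then have "AE t in ?M. t \<notin> N"
      using interval_sets_lebesgue[of 0 T] by (auto simp: AE_restrict_space_iff elim: eventually_mono)
    then show "AE t in ?M. indicator A t = (indicator C t :: real)"
      using C(3) by (auto simp: indicator_def elim!: eventually_mono)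
  qed
  ultimately show "?I (indicator A) = 0" using zero_borel by simp
qed

section \<open>Limits of means over shrinking intervals\<close>

context
  fixes T :: real and f w :: "real \<Rightarrow> 'x::banach"
  assumes T: "0 < T" and f: "bochner_integrable (lebesgue_on {0<..<T}) f"
    and w: "w \<in> BMO_star T" and fw: "distributional_derivative T f w"
begin

text \<open>By \<open>BMO_integral_le\<close> this bounds the integral of the norm of
  \<open>w\<close> over an interval of length at most \<open>T / 2 ^ k\<close>, and hence the
  difference of two means of \<open>f\<close> within such an interval.\<close>

definition osc_bound :: "nat \<Rightarrow> real" where
  "osc_bound k = T / 2 ^ k * ((2 + 2 * real k) * enn2real (BMO_star_norm T w))"

lemma osc_bound_nonneg: "0 \<le> osc_bound k"
  using T by (simp add: osc_bound_def)

lemma osc_bound_tendsto_0: "osc_bound \<longlonglongrightarrow> 0"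
proof -
  have "(\<lambda>k. T * enn2real (BMO_star_norm T w) * ((2 + 2 * real k) / 2 ^ k))
      \<longlonglongrightarrow> T * enn2real (BMO_star_norm T w) * 0"
    by (intro tendsto_mult tendsto_const) real_asymp
  moreover have "(\<lambda>k. T * enn2real (BMO_star_norm T w) * ((2 + 2 * real k) / 2 ^ k)) = osc_bound"
    by (simp add: fun_eq_iff osc_bound_def)
  ultimately show ?thesis by simp
qed

lemma mean_diff_le_osc_bound:
  assumes "0 \<le> p" "q \<le> T" "q - p \<le> T / 2 ^ k" "p \<le> a" "a < b" "b \<le> q" "p \<le> c" "c < d" "d \<le> q"
  shows "norm (interval_mean {a<..<b} f - interval_mean {c<..<d} f) \<le> osc_bound k"
proof -
  have "ennreal (norm (interval_mean {a<..<b} f - interval_mean {c<..<d} f))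
      \<le> (\<integral>\<^sup>+t\<in>{p<..<q}. ennreal (norm (w t)) \<partial>lebesgue)"
    by (rule interval_mean_diff_le_derivative[OF f BMO_star_integrable[OF T w] fw assms(1,2,4-9)])
  also have "\<dots> \<le> ennreal (osc_bound k)"
    unfolding osc_bound_def using assms by (intro BMO_integral_le[OF T w]) auto
  finally show ?thesis by (simp add: osc_bound_nonneg)
qed

text \<open>The interval ends at \<open>t\<close>, except near 0, where it is moved right to start
  at 0. It thus always has the full length that \<open>BMO_mean_le\<close> asks for, contains
  \<open>t\<close> in its closure, and shrinks in a nested way as \<open>k\<close> grows.\<close>

definition left_end :: "nat \<Rightarrow> real \<Rightarrow> real" where
  "left_end k t = max 0 (t - T / 2 ^ k)"

definition local_mean :: "nat \<Rightarrow> real \<Rightarrow> 'x" where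
  "local_mean k t = interval_mean {left_end k t<..<left_end k t + T / 2 ^ k} f"

definition representative :: "real \<Rightarrow> 'x" where
  "representative t = lim (\<lambda>k. local_mean k t)"

lemma dyadic_length: "0 < T / 2 ^ k" "T / 2 ^ k \<le> T" "T / 2 ^ Suc k = T / 2 ^ k / 2"
  using T by (auto simp: field_simps)

lemma left_end_bounds:
  assumes "t \<in> {0..T}"
  shows "0 \<le> left_end k t" "left_end k t + T / 2 ^ k \<le> T"
  using assms dyadic_length[of k] by (auto simp: left_end_def)

lemma dyadic_antimono: "k \<le> m \<Longrightarrow> T / 2 ^ m \<le> T / 2 ^ k"
  using T by (intro divide_left_mono) auto

lemma local_mean_diff_le:
  assumes t: "t \<in> {0..T}" and "k \<le> m"
  shows "norm (local_mean m t - local_mean k t) \<le> osc_bound k"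
  unfolding local_mean_def using dyadic_antimono[OF assms(2)] left_end_bounds[OF t] dyadic_length t
  by (intro mean_diff_le_osc_bound[where p = "left_end k t" and q = "left_end k t + T / 2 ^ k"])
    (auto simp: left_end_def)

lemma local_mean_tendsto:
  assumes t: "t \<in> {0..T}"
  shows "(\<lambda>k. local_mean k t) \<longlonglongrightarrow> representative t"
proof -
  have "Cauchy (\<lambda>k. local_mean k t)"
  proof (rule CauchyI')
    fix e :: real assume "0 < e"
    with order_tendstoD(2)[OF osc_bound_tendsto_0] obtain k where k: "\<And>m. k \<le> m \<Longrightarrow> osc_bound m < e"
      by (auto simp: eventually_sequentially)
    show "\<exists>M. \<forall>m\<ge>M. \<forall>n>m. dist (local_mean m t) (local_mean n t) < e"
    proof (intro exI[of _ k] allI impI)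
      fix m n assume "k \<le> m" "m < n"
      then have "norm (local_mean n t - local_mean m t) \<le> osc_bound m"
        using local_mean_diff_le[OF t] by simp
      also have "\<dots> < e" using k[OF \<open>k \<le> m\<close>] .
      finally show "dist (local_mean m t) (local_mean n t) < e" by (simp add: dist_norm norm_minus_commute)
    qed
  qed
  then show ?thesis
    unfolding representative_def by (simp add: Cauchy_convergent_iff convergent_LIMSEQ_iff)
qed

lemma representative_diff_local_mean_le:
  assumes t: "t \<in> {0..T}"
  shows "norm (representative t - local_mean k t) \<le> osc_bound k"
proof (rule LIMSEQ_le_const2)
  show "(\<lambda>m. norm (local_mean m t - local_mean k t)) \<longlonglongrightarrow> norm (representative t - local_mean k t)"
    by (intro tendsto_intros local_mean_tendsto t)
  show "\<exists>N. \<forall>m\<ge>N. norm (local_mean m t - local_mean k t) \<le> osc_bound k"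
    using local_mean_diff_le[OF t] by blast
qed

lemma representative_modulus:
  assumes "s \<in> {0..T}" "t \<in> {0..T}" "\<bar>s - t\<bar> \<le> T / 2 ^ Suc k"
  shows "norm (representative s - representative t) \<le> 2 * osc_bound (Suc k) + osc_bound k"
  using assms
proof (induction s t rule: linorder_wlog)
  case (le s t)
  have "norm (local_mean (Suc k) s - local_mean (Suc k) t) \<le> osc_bound k"
  proof -
    have "left_end (Suc k) s \<le> left_end (Suc k) t" "left_end (Suc k) t - left_end (Suc k) s \<le> t - s"
      unfolding left_end_def max_def using le(1) by argo+
    moreover define h where "h = T / 2 ^ Suc k"
    moreover have "T / 2 ^ k = 2 * h" "0 < h"
      using dyadic_length(1)[of "Suc k"] dyadic_length(3)[of k] by (simp_all add: h_def)
    moreover have "0 \<le> left_end (Suc k) s" "left_end (Suc k) t + h \<le> T" "t - s \<le> h"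
      using left_end_bounds[OF le(2), of "Suc k"] left_end_bounds[OF le(3), of "Suc k"] le(1,4)
      unfolding h_def by auto
    ultimately show ?thesis
      unfolding local_mean_def h_def[symmetric]
      by (intro mean_diff_le_osc_bound[where p = "left_end (Suc k) s" and q = "left_end (Suc k) t + h"]) auto
  qed
  moreover have "norm (representative s - local_mean (Suc k) s) \<le> osc_bound (Suc k)"
    "norm (representative t - local_mean (Suc k) t) \<le> osc_bound (Suc k)"
    using le representative_diff_local_mean_le by auto
  moreover have "representative s - representative t = (representative s - local_mean (Suc k) s)
      + (local_mean (Suc k) s - local_mean (Suc k) t) - (representative t - local_mean (Suc k) t)"
    by simp
  then have "norm (representative s - representative t) \<le> norm (representative s - local_mean (Suc k) s)
      + norm (local_mean (Suc k) s - local_mean (Suc k) t) + norm (representative t - local_mean (Suc k) t)"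
    by (simp only:) (rule order_trans[OF norm_triangle_ineq4 add_right_mono[OF norm_triangle_ineq]])
  ultimately show ?case by linarith
next
  case (sym s t)
  then show ?case by (simp add: norm_minus_commute abs_minus_commute)
qed

lemma modulus_tendsto_0: "(\<lambda>k. 2 * osc_bound (Suc k) + osc_bound k) \<longlonglongrightarrow> 0"
  using tendsto_add[OF tendsto_mult[OF tendsto_const[of 2] LIMSEQ_Suc[OF osc_bound_tendsto_0]] osc_bound_tendsto_0]
  by simp

lemma representative_continuous: "continuous_on {0..T} representative"
  unfolding continuous_on_iff
proof (intro ballI allI impI)
  fix t e :: real assume t: "t \<in> {0..T}" and "0 < e"
  with order_tendstoD(2)[OF modulus_tendsto_0] obtain k where k: "2 * osc_bound (Suc k) + osc_bound k < e"
    by (auto simp: eventually_sequentially)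
  show "\<exists>d>0. \<forall>s\<in>{0..T}. dist s t < d \<longrightarrow> dist (representative s) (representative t) < e"
  proof (intro exI[of _ "T / 2 ^ Suc k"] conjI ballI impI)
    fix s assume "s \<in> {0..T}" "dist s t < T / 2 ^ Suc k"
    then show "dist (representative s) (representative t) < e"
      using representative_modulus[of s t k] k t by (simp add: dist_norm del: power_Suc)
  qed (rule dyadic_length)
qed

definition step_approx :: "nat \<Rightarrow> real \<Rightarrow> 'x" where
  "step_approx n t = representative (real_of_int \<lfloor>2 ^ Suc n * t / T\<rfloor> * T / 2 ^ Suc n)"

lemma floor_grid:
  assumes "0 < t" "t < T"
  shows "real_of_int \<lfloor>2 ^ Suc n * t / T\<rfloor> * T / 2 ^ Suc n \<in> {0..T}"
    and "\<bar>t - real_of_int \<lfloor>2 ^ Suc n * t / T\<rfloor> * T / 2 ^ Suc n\<bar> \<le> T / 2 ^ Suc n"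
    and "\<lfloor>2 ^ Suc n * t / T\<rfloor> \<in> {0..2 ^ Suc n}"
proof -
  define P where "P = (2::real) ^ Suc n"
  have P: "0 < P" by (simp add: P_def)
  define z where "z = real_of_int \<lfloor>P * t / T\<rfloor>"
  have z: "z \<le> P * t / T" "P * t / T < z + 1" "0 \<le> z"
    using assms P by (auto simp: z_def)
  have 1: "z * T \<le> P * t" "P * t < z * T + T"
    using z T by (auto simp: field_simps)
  have 2: "z * T / P \<le> t" "t < z * T / P + T / P" "0 \<le> z * T / P"
    using 1 z P T by (auto simp: field_simps)
  show "real_of_int \<lfloor>2 ^ Suc n * t / T\<rfloor> * T / 2 ^ Suc n \<in> {0..T}"
    "\<bar>t - real_of_int \<lfloor>2 ^ Suc n * t / T\<rfloor> * T / 2 ^ Suc n\<bar> \<le> T / 2 ^ Suc n"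
    using 2 assms unfolding P_def[symmetric] z_def[symmetric] by auto
  have "P * t / T \<le> P" using assms P T by (simp add: field_simps)
  then have "z \<le> real_of_int (2 ^ Suc n)" using z by (simp add: P_def)
  then show "\<lfloor>2 ^ Suc n * t / T\<rfloor> \<in> {0..2 ^ Suc n}"
    using z(3) unfolding P_def[symmetric] z_def by (simp del: power_Suc)
qed

lemma step_approx_close:
  assumes "0 < t" "t < T"
  shows "norm (representative t - step_approx n t) \<le> 2 * osc_bound (Suc n) + osc_bound n"
  unfolding step_approx_def using floor_grid[OF assms, of n] assms
  by (intro representative_modulus) auto

lemma step_approx_simple: "simple_integrable_B (lebesgue_on {0<..<T}) (step_approx n)"
proof (rule simple_bochner_integrable.intros)
  let ?M = "lebesgue_on {0<..<T}"
  have "(\<lambda>t. 2 ^ Suc n * t / T) \<in> borel_measurable ?M"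
    by (intro continuous_imp_measurable_on_sets_lebesgue interval_sets_lebesgue continuous_intros) (use T in auto)
  then have "(\<lambda>t. \<lfloor>2 ^ Suc n * t / T\<rfloor>) \<in> measurable ?M (count_space UNIV)"
    by (rule measurable_compose[OF _ measurable_real_floor])
  from measurable_sets[OF this]
  have "(\<lambda>t. \<lfloor>2 ^ Suc n * t / T\<rfloor>) -` {z} \<inter> space ?M \<in> sets ?M" for z
    by simp
  moreover have "(\<lambda>t. \<lfloor>2 ^ Suc n * t / T\<rfloor>) ` space ?M \<subseteq> {0..2 ^ Suc n}"
    using floor_grid(3)[of _ n] by auto
  then have "finite ((\<lambda>t. \<lfloor>2 ^ Suc n * t / T\<rfloor>) ` space ?M)"
    by (rule finite_subset) simp
  ultimately have "simple_function ?M (\<lambda>t. \<lfloor>2 ^ Suc n * t / T\<rfloor>)"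
    unfolding simple_function_def by blast
  from simple_function_compose1[OF this, of "\<lambda>z. representative (real_of_int z * T / 2 ^ Suc n)"]
  show "simple_function ?M (step_approx n)" by (simp add: step_approx_def[abs_def])
  have "emeasure ?M {y \<in> space ?M. step_approx n y \<noteq> 0} \<le> emeasure ?M (space ?M)"
    by (rule emeasure_space)
  also have "\<dots> < \<infinity>" using T by (simp add: emeasure_restrict_space interval_sets_lebesgue)
  finally show "emeasure ?M {y \<in> space ?M. step_approx n y \<noteq> 0} \<noteq> \<infinity>" by simp
qed

lemma step_approx_tendsto:
  assumes "0 < t" "t < T"
  shows "(\<lambda>n. step_approx n t) \<longlonglongrightarrow> representative t"
proof -
  have "(\<lambda>n. norm (representative t - step_approx n t)) \<longlonglongrightarrow> 0"
    using step_approx_close[OF assms] by (intro tendsto_sandwich[OF _ _ tendsto_const modulus_tendsto_0]) auto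
  then have "(\<lambda>n. representative t - step_approx n t) \<longlonglongrightarrow> 0" by (simp add: tendsto_norm_zero_iff)
  from tendsto_diff[OF tendsto_const[of "representative t"] this] show ?thesis by simp
qed

lemma representative_integrable: "bochner_integrable (lebesgue_on {0<..<T}) representative"
proof (rule bochner_integrableI_approx[OF _ step_approx_simple])
  let ?M = "lebesgue_on {0<..<T}"
  show "representative \<in> borel_measurable ?M"
  proof (rule borel_measurable_LIMSEQ_metric)
    show "step_approx n \<in> borel_measurable ?M" for n
      by (intro borel_measurable_simple_function simple_integrable_B_simple step_approx_simple)
    show "(\<lambda>n. step_approx n t) \<longlonglongrightarrow> representative t" if "t \<in> space ?M" for t
      using that by (intro step_approx_tendsto) auto
  qed
  have "(\<integral>\<^sup>+t. ennreal (norm (representative t - step_approx n t)) \<partial>?M)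
      \<le> ennreal ((2 * osc_bound (Suc n) + osc_bound n) * T)" for n
  proof -
    have "(\<integral>\<^sup>+t. ennreal (norm (representative t - step_approx n t)) \<partial>?M)
        \<le> (\<integral>\<^sup>+t. ennreal (2 * osc_bound (Suc n) + osc_bound n) \<partial>?M)"
      using step_approx_close by (intro nn_integral_mono ennreal_leI) auto
    also have "\<dots> = ennreal ((2 * osc_bound (Suc n) + osc_bound n) * T)"
      using T osc_bound_nonneg by (simp add: emeasure_restrict_space interval_sets_lebesgue ennreal_mult)
    finally show ?thesis .
  qed
  moreover have "(\<lambda>n. ennreal ((2 * osc_bound (Suc n) + osc_bound n) * T)) \<longlonglongrightarrow> 0"
    using tendsto_ennrealI[OF tendsto_mult[OF modulus_tendsto_0 tendsto_const[of T]]] by simp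
  ultimately show "(\<lambda>n. \<integral>\<^sup>+t. ennreal (norm (representative t - step_approx n t)) \<partial>?M) \<longlonglongrightarrow> 0"
    by (rule ennreal_tendsto_0_le[rotated])
qed

text \<open>Subtracting a simple function preserves measurability, and so does the pointwise
  limit.\<close>

lemma difference_measurable: "(\<lambda>t. f t - representative t) \<in> borel_measurable (lebesgue_on {0<..<T})"
proof (rule borel_measurable_LIMSEQ_metric)
  show "(\<lambda>t. f t - step_approx n t) \<in> borel_measurable (lebesgue_on {0<..<T})" for n
    by (intro borel_measurable_diff_simple bochner_integrable_measurable f
        simple_integrable_B_simple step_approx_simple)
  show "(\<lambda>n. f t - step_approx n t) \<longlonglongrightarrow> f t - representative t" if "t \<in> space (lebesgue_on {0<..<T})" for t
    using that by (intro tendsto_intros step_approx_tendsto) auto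
qed

lemma difference_integrable: "bochner_integrable (lebesgue_on {0<..<T}) (\<lambda>t. f t - representative t)"
  using has_bochner_diff[OF has_bochner_bochner_integral[OF f]
      has_bochner_bochner_integral[OF representative_integrable] difference_measurable]
  by (auto simp: bochner_integrable_def)

text \<open>At every inner point \<open>t\<close> the local means are eventually means over
  subintervals of \<open>(x, y)\<close>, hence close to the mean of \<open>f\<close> over
  \<open>(x, y)\<close>; so is their limit, and averaging over \<open>t\<close> keeps the
  bound.\<close>

lemma mean_representative_diff_le:
  assumes xy: "0 \<le> x" "x < y" "y \<le> T" and k: "y - x \<le> T / 2 ^ k"
  shows "norm (interval_mean {x<..<y} representative - interval_mean {x<..<y} f) \<le> osc_bound k"
proof -
  let ?m = "interval_mean {x<..<y} f"
  have close: "norm (representative t - ?m) \<le> osc_bound k" if t: "x < t" "t < y" for t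
  proof (rule LIMSEQ_le_const2)
    have t0: "t \<in> {0..T}" using t xy by auto
    show "(\<lambda>j. norm (local_mean j t - ?m)) \<longlonglongrightarrow> norm (representative t - ?m)"
      by (intro tendsto_intros local_mean_tendsto t0)
    \<comment> \<open>Once \<open>T / 2 ^ j < t - x\<close>, the local mean is taken over
      \<open>(t - T / 2 ^ j, t)\<close>, which lies inside \<open>(x, y)\<close>.\<close>
    have "(\<lambda>j. T / 2 ^ j) \<longlonglongrightarrow> 0" by real_asymp
    from order_tendstoD(2)[OF this, of "t - x"] t obtain N where N: "\<And>j. N \<le> j \<Longrightarrow> T / 2 ^ j < t - x"
      by (auto simp: eventually_sequentially)
    show "\<exists>N. \<forall>j\<ge>N. norm (local_mean j t - ?m) \<le> osc_bound k"
    proof (intro exI[of _ N] allI impI)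
      fix j assume "N \<le> j"
      from N[OF this] show "norm (local_mean j t - ?m) \<le> osc_bound k"
        unfolding local_mean_def using xy k t dyadic_length(1)[of j]
        by (intro mean_diff_le_osc_bound[where p = x and q = y]) (auto simp: left_end_def)
    qed
  qed
  have "ennreal ((y - x) * norm (interval_mean {x<..<y} representative - ?m))
      \<le> (\<integral>\<^sup>+t\<in>{x<..<y}. ennreal (norm (representative t - ?m)) \<partial>lebesgue)"
    by (rule norm_interval_mean_diff_le[OF representative_integrable xy])
  also have "\<dots> \<le> (\<integral>\<^sup>+t. ennreal (osc_bound k) * indicator {x<..<y} t \<partial>lebesgue)"
    using close by (intro nn_integral_mono) (auto simp: indicator_def intro!: ennreal_leI)
  also have "\<dots> = ennreal ((y - x) * osc_bound k)"
    using xy by (subst nn_integral_cmult_indicator) (auto simp: interval_sets_lebesgue ennreal_mult osc_bound_nonneg mult.commute)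
  finally show ?thesis
    using xy osc_bound_nonneg[of k] by (subst (asm) ennreal_le_iff) auto
qed

text \<open>The increments of this primitive are of smaller order than the length of the interval, so it is
  constant.\<close>

definition difference_primitive :: "real \<Rightarrow> 'x" where
  "difference_primitive x
    = weighted_integral (lebesgue_on {0<..<T}) (\<lambda>t. f t - representative t) (indicator {0<..<x})"

lemma difference_primitive_diff_le:
  assumes "x \<in> {0..T}" "y \<in> {0..T}" "\<bar>y - x\<bar> \<le> T / 2 ^ k"
  shows "norm (difference_primitive y - difference_primitive x) \<le> osc_bound k * \<bar>y - x\<bar>"
  using assms
proof (induction x y rule: linorder_wlog)
  case (le x y)
  let ?M = "lebesgue_on {0<..<T}"
  let ?I = "weighted_integral ?M (\<lambda>t. f t - representative t)"
  have J: "{0<..<x} \<in> sets ?M" "{0<..<y} \<in> sets ?M" "{x<..<y} \<in> sets ?M"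
    using le by (auto intro!: measurable_interval_lebesgue_on)
  have "difference_primitive y - difference_primitive x = ?I (\<lambda>t. indicator {0<..<y} t - indicator {0<..<x} t)"
    unfolding difference_primitive_def
    by (intro weighted_integral_diff[OF difference_integrable, symmetric] bounded_weight_indicator J)
  also have "\<dots> = ?I (indicator {x<..<y})"
  proof (intro weighted_integral_AE_cong[OF difference_integrable] bounded_weight_diff bounded_weight_indicator J)
    have "AE t in lebesgue. t \<noteq> x"
      by (rule AE_I'[of "{x}"]) auto
    then have "AE t in ?M. t \<noteq> x"
      by (auto simp: AE_restrict_space_iff interval_sets_lebesgue elim: eventually_mono)
    then show "AE t in ?M. indicator {0<..<y} t - indicator {0<..<x} t = (indicator {x<..<y} t :: real)"
      using le by (auto simp: indicator_def elim!: eventually_mono)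
  qed
  also have "\<dots> = weighted_integral ?M f (indicator {x<..<y}) - weighted_integral ?M representative (indicator {x<..<y})"
    by (intro weighted_integral_minus_fun f representative_integrable difference_measurable bounded_weight_indicator J)
  finally have eq: "difference_primitive y - difference_primitive x
      = weighted_integral ?M f (indicator {x<..<y}) - weighted_integral ?M representative (indicator {x<..<y})" .
  show ?case
  proof (cases "x = y")
    case False
    with le have xy: "0 \<le> x" "x < y" "y \<le> T" by auto
    have "difference_primitive y - difference_primitive x
        = (y - x) *\<^sub>R (interval_mean {x<..<y} f - interval_mean {x<..<y} representative)"
      unfolding eq interval_mean_weighted[OF f xy] interval_mean_weighted[OF representative_integrable xy]
      using xy by (simp add: scaleR_diff_right[symmetric])
    then have "norm (difference_primitive y - difference_primitive x)
        = (y - x) * norm (interval_mean {x<..<y} representative - interval_mean {x<..<y} f)"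
      using xy by (simp add: norm_minus_commute)
    also have "\<dots> \<le> (y - x) * osc_bound k"
      using mean_representative_diff_le[OF xy, of k] le xy by (intro mult_left_mono) auto
    finally show ?thesis using xy by (simp add: mult.commute)
  qed simp
next
  case (sym x y)
  then show ?case by (simp add: norm_minus_commute abs_minus_commute)
qed

lemma difference_primitive_zero:
  assumes "x \<in> {0..T}"
  shows "difference_primitive x = 0"
proof -
  have "(difference_primitive has_derivative (\<lambda>h. 0)) (at x within {0..T})" if x: "x \<in> {0..T}" for x
    unfolding has_derivative_within_alt
  proof (intro conjI allI impI)
    fix e :: real assume "0 < e"
    with order_tendstoD(2)[OF osc_bound_tendsto_0] obtain k where k: "osc_bound k < e"
      by (auto simp: eventually_sequentially)
    show "\<exists>d>0. \<forall>y\<in>{0..T}. norm (y - x) < d \<longrightarrow>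
        norm (difference_primitive y - difference_primitive x - 0) \<le> e * norm (y - x)"
    proof (intro exI[of _ "T / 2 ^ k"] conjI ballI impI dyadic_length)
      fix y assume "y \<in> {0..T}" "norm (y - x) < T / 2 ^ k"
      then have "norm (difference_primitive y - difference_primitive x) \<le> osc_bound k * \<bar>y - x\<bar>"
        using x by (intro difference_primitive_diff_le) auto
      also have "\<dots> \<le> e * \<bar>y - x\<bar>" using k by (intro mult_right_mono) auto
      finally show "norm (difference_primitive y - difference_primitive x - 0) \<le> e * norm (y - x)" by simp
    qed
  qed simp
  then obtain c where c: "\<And>x. x \<in> {0..T} \<Longrightarrow> difference_primitive x = c"
    using has_derivative_zero_constant[of "{0..T}" difference_primitive] by auto
  have "difference_primitive 0 = 0"
    using bochner_integral_norm_le[of "lebesgue_on {0<..<T}" "\<lambda>_. 0 :: 'x"]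
    by (simp add: difference_primitive_def weighted_integral_def)
  with c[of 0] c[OF assms] T show ?thesis by simp
qed

text \<open>The vanishing primitive says that the difference has integral 0 over each initial
  interval.\<close>

lemma representative_AE_eq: "AE t in lebesgue_on {0<..<T}. representative t = f t"
proof -
  have "AE t in lebesgue_on {0<..<T}. f t - representative t = 0"
    using difference_primitive_zero unfolding difference_primitive_def
    by (intro AE_zero_if_initial_integrals_zero[OF T difference_integrable]) auto
  then show ?thesis by (auto elim: eventually_mono)
qed

end

section \<open>The real interpolation norm\<close>

lemma nn_integral_two_powers_le:
  fixes \<alpha> \<beta> :: real
  assumes "0 < \<alpha>" "0 < \<beta>"
  shows "(\<integral>\<^sup>+r. ennreal (if r \<le> 1 then r powr (\<alpha> - 1) else r powr (- \<beta> - 1)) \<partial>lebesgue_on {0<..})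
    \<le> ennreal (1 / \<alpha> + 1 / \<beta>)"
proof -
  have 1: "((\<lambda>r. r powr (\<alpha> - 1)) has_integral 1 / \<alpha>) {0..1}"
    using has_integral_powr_from_0[of "\<alpha> - 1" 1] assms by simp
  have 2: "((\<lambda>r. r powr (- \<beta> - 1)) has_integral 1 / \<beta>) {1..}"
    using has_integral_powr_to_inf[of "- \<beta> - 1" 1] assms by simp
  have "(\<integral>\<^sup>+r. ennreal (if r \<le> 1 then r powr (\<alpha> - 1) else r powr (- \<beta> - 1)) \<partial>lebesgue_on {0<..})
      = (\<integral>\<^sup>+r. ennreal (if r \<le> 1 then r powr (\<alpha> - 1) else r powr (- \<beta> - 1)) * indicator {0<..} r \<partial>lborel)"
    by (subst nn_integral_restrict_space) (auto simp: nn_integral_completion intro: sets_completionI_sets)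
  also have "\<dots> \<le> (\<integral>\<^sup>+r. ennreal (r powr (\<alpha> - 1)) * indicator {0..1} r
      + ennreal (r powr (- \<beta> - 1)) * indicator {1..} r \<partial>lborel)"
    by (intro nn_integral_mono) (auto simp: indicator_def)
  also have "\<dots> = (\<integral>\<^sup>+r. ennreal (r powr (\<alpha> - 1)) * indicator {0..1} r \<partial>lborel)
      + (\<integral>\<^sup>+r. ennreal (r powr (- \<beta> - 1)) * indicator {1..} r \<partial>lborel)"
    by (rule nn_integral_add) auto
  also have "\<dots> = ennreal (1 / \<alpha>) + ennreal (1 / \<beta>)"
    using nn_integral_has_integral_lebesgue'[OF _ 1] nn_integral_has_integral_lebesgue'[OF _ 2] by simp
  finally show ?thesis using assms by (simp flip: ennreal_plus)
qed

lemma K_functional_le: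
  assumes "x = j0 x0 + j1 x1" and "0 \<le> r"
  shows "K_functional j0 j1 r x \<le> norm x0 + r * norm x1"
  unfolding K_functional_def
  using assms by (intro cInf_lower bdd_belowI[of _ 0]) auto

lemma K_functional_nonneg:
  assumes "x = j0 x0 + j1 x1" and "0 \<le> r"
  shows "0 \<le> K_functional j0 j1 r x"
  unfolding K_functional_def
  using assms by (intro cInf_greatest) auto

text \<open>Splitting at \<open>r = 1\<close> leaves the powers
  \<open>(\<tau> - \<theta>) * q - 1\<close> near 0 and \<open>- (\<theta> * q) - 1\<close> at
  infinity, both integrable. It is applied with two values of \<open>\<tau>\<close>: one for the
  size of the representative, a smaller one for its increments.\<close>

lemma interp_integral_le:
  assumes \<theta>: "0 < \<theta>" "\<theta> < \<tau>" and q: "0 < q" and B: "0 \<le> B"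
    and K: "\<And>r. 0 < r \<Longrightarrow> 0 \<le> K_functional j0 j1 r x"
    "\<And>r. 0 < r \<Longrightarrow> K_functional j0 j1 r x \<le> B * min 1 (r powr \<tau>)"
  shows "interp_integral j0 j1 \<theta> q x
    \<le> ennreal (B powr q * (1 / ((\<tau> - \<theta>) * q) + 1 / (\<theta> * q)))"
proof -
  define d where "d r = (if r \<le> 1 then r powr ((\<tau> - \<theta>) * q - 1) else r powr (- (\<theta> * q) - 1))" for r :: real
  have pos: "0 < (\<tau> - \<theta>) * q" "0 < \<theta> * q" using \<theta> q by auto
  have "(r powr (- \<theta>) * K_functional j0 j1 r x) powr q / r \<le> B powr q * d r" if r: "0 < r" for r
  proof -
    have "(r powr (- \<theta>) * K_functional j0 j1 r x) powr q / r
        \<le> (r powr (- \<theta>) * (B * min 1 (r powr \<tau>))) powr q / r"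
      using r q K by (intro divide_right_mono powr_mono2 mult_left_mono) auto
    also have "\<dots> = B powr q * (((r powr (- \<theta>) * min 1 (r powr \<tau>)) powr q) / r)"
      using B by (simp add: powr_mult mult_ac)
    also have "(r powr (- \<theta>) * min 1 (r powr \<tau>)) powr q / r = d r"
    proof (cases "r \<le> 1")
      case True
      then have "r powr \<tau> \<le> 1" using \<theta> r by (intro powr_le1) auto
      then have "(r powr (- \<theta>) * min 1 (r powr \<tau>)) powr q / r = (r powr (\<tau> - \<theta>)) powr q / r"
        by (simp add: powr_add[symmetric])
      also have "\<dots> = r powr ((\<tau> - \<theta>) * q - 1)"
        using r by (simp add: powr_powr powr_diff[of r _ 1])
      finally show ?thesis using True by (simp add: d_def)
    next
      case False
      then have "1 \<le> r powr \<tau>" using \<theta> by (intro ge_one_powr_ge_zero) auto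
      then have "(r powr (- \<theta>) * min 1 (r powr \<tau>)) powr q / r = (r powr (- \<theta>)) powr q / r"
        by simp
      also have "\<dots> = r powr (- (\<theta> * q) - 1)"
        using r by (simp add: powr_powr powr_diff)
      finally show ?thesis using False by (simp add: d_def)
    qed
    finally show ?thesis .
  qed
  then have "interp_integral j0 j1 \<theta> q x \<le> (\<integral>\<^sup>+r. ennreal (B powr q) * ennreal (d r) \<partial>lebesgue_on {0<..})"
    unfolding interp_integral_def
    by (intro nn_integral_mono) (auto simp: ennreal_mult[symmetric] d_def intro!: ennreal_leI)
  also have "\<dots> = ennreal (B powr q) * (\<integral>\<^sup>+r. ennreal (d r) \<partial>lebesgue_on {0<..})"
  proof (rule nn_integral_cmult)
    have "d \<in> borel_measurable borel" unfolding d_def[abs_def] by measurable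
    then have "d \<in> borel_measurable lebesgue" by (intro measurable_completion) simp
    then have "d \<in> borel_measurable (lebesgue_on {0<..})" by (rule measurable_restrict_space1)
    then show "(\<lambda>r. ennreal (d r)) \<in> borel_measurable (lebesgue_on {0<..})" by simp
  qed
  also have "\<dots> \<le> ennreal (B powr q) * ennreal (1 / ((\<tau> - \<theta>) * q) + 1 / (\<theta> * q))"
    unfolding d_def[abs_def] by (intro mult_left_mono nn_integral_two_powers_le pos) simp
  finally show ?thesis using pos by (simp add: ennreal_mult)
qed

text \<open>The integral is finite by \<open>interp_integral_le\<close>, so the bound does not come
  from the value 0 that \<open>enn2real\<close> assigns to infinity.\<close>

lemma interp_norm_le:
  assumes "0 < \<theta>" "\<theta> < \<tau>" "0 < q" "0 \<le> B"
    and "\<And>r. 0 < r \<Longrightarrow> 0 \<le> K_functional j0 j1 r x"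
    and "\<And>r. 0 < r \<Longrightarrow> K_functional j0 j1 r x \<le> B * min 1 (r powr \<tau>)"
  shows "interp_norm j0 j1 \<theta> q x \<le> B * (1 / ((\<tau> - \<theta>) * q) + 1 / (\<theta> * q)) powr (1 / q)"
proof -
  define D where "D = 1 / ((\<tau> - \<theta>) * q) + 1 / (\<theta> * q)"
  have D: "0 \<le> D" using assms(1-3) by (simp add: D_def)
  have "enn2real (interp_integral j0 j1 \<theta> q x) \<le> B powr q * D"
    using interp_integral_le[OF assms] D unfolding D_def by (intro enn2real_leI) auto
  then have "interp_norm j0 j1 \<theta> q x \<le> (B powr q * D) powr (1 / q)"
    unfolding interp_norm_def using assms(3) by (intro powr_mono2) auto
  also have "\<dots> = B * D powr (1 / q)"
    using assms(3,4) D by (simp add: powr_mult powr_powr)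
  finally show ?thesis by (simp add: D_def)
qed

section \<open>Interpolating between two bounds, and splitting the representative at a given
  scale\<close>

lemma le_geometric_mean:
  fixes K a b :: real
  assumes "0 \<le> K" "K \<le> a" "K \<le> b" "0 < \<eta>" "\<eta> < 1"
  shows "K \<le> a powr \<eta> * b powr (1 - \<eta>)"
proof -
  have "K = K powr \<eta> * K powr (1 - \<eta>)"
    using assms by (simp add: powr_add[symmetric])
  also have "\<dots> \<le> a powr \<eta> * b powr (1 - \<eta>)"
    using assms by (intro mult_mono powr_mono2) auto
  finally show ?thesis .
qed

text \<open>With \<open>k = \<lfloor>log\<^sub>2 (1 / r)\<rfloor>\<close>; the logarithm is absorbed by the power \<open>r powr - \<epsilon>\<close>.\<close>

lemma dyadic_scale:
  fixes r \<epsilon> :: real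
  assumes "0 < r" "r \<le> 1" "0 < \<epsilon>"
  obtains k :: nat where "(2 + 2 * real k) * (1 / 2 ^ k + r) \<le> 6 * (1 + 1 / (\<epsilon> * ln 2)) * r powr (1 - \<epsilon>)"
proof -
  define L where "L = log 2 (1 / r)"
  have L0: "0 \<le> L" using assms by (simp add: L_def)
  define k where "k = nat \<lfloor>L\<rfloor>"
  have k: "real k \<le> L" "L < real k + 1" using L0 by (auto simp: k_def)
  have "1 / r = 2 powr L" using assms by (simp add: L_def)
  also have "\<dots> \<le> 2 powr (real k + 1)" using k by (intro powr_mono) auto
  also have "\<dots> = 2 * 2 ^ k" by (simp add: powr_add powr_realpow)
  finally have r: "1 / 2 ^ k \<le> 2 * r" using assms by (simp add: field_simps)
  have ln: "L = ln (1 / r) / ln 2" by (simp add: L_def log_def)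
  have "1 + \<epsilon> * ln (1 / r) \<le> exp (\<epsilon> * ln (1 / r))" by (rule exp_ge_add_one_self)
  also have "\<dots> = r powr (- \<epsilon>)" using assms by (simp add: powr_def ln_div)
  finally have e: "1 + \<epsilon> * ln (1 / r) \<le> r powr (- \<epsilon>)" .
  moreover have "0 \<le> ln (1 / r)" using assms by simp
  ultimately have "1 \<le> r powr (- \<epsilon>)" "ln (1 / r) \<le> r powr (- \<epsilon>) / \<epsilon>"
    using assms by (auto simp: field_simps intro: order_trans[rotated])
  then have "1 + real k \<le> r powr (- \<epsilon>) + r powr (- \<epsilon>) / \<epsilon> / ln 2"
    using k(1) unfolding ln by (intro add_mono order_trans[OF k(1)[unfolded ln]] divide_right_mono) auto
  also have "\<dots> = (1 + 1 / (\<epsilon> * ln 2)) * r powr (- \<epsilon>)" by (simp add: field_simps)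
  finally have k': "1 + real k \<le> (1 + 1 / (\<epsilon> * ln 2)) * r powr (- \<epsilon>)" .
  \<comment> \<open>The constant 6 is 2 from \<open>2 + 2 * real k\<close> times 3 from
    \<open>1 / 2 ^ k + r \<le> 3 * r\<close>.\<close>
  have "(2 + 2 * real k) * (1 / 2 ^ k + r) \<le> (2 + 2 * real k) * (3 * r)"
    using r by (intro mult_left_mono) auto
  also have "\<dots> = 6 * r * (1 + real k)" by (simp add: algebra_simps)
  also have "\<dots> \<le> 6 * r * ((1 + 1 / (\<epsilon> * ln 2)) * r powr (- \<epsilon>))"
    using assms k' by (intro mult_left_mono) auto
  also have "\<dots> = 6 * (1 + 1 / (\<epsilon> * ln 2)) * (r powr 1 * r powr (- \<epsilon>))"
    using assms by simp
  also have "r powr 1 * r powr (- \<epsilon>) = r powr (1 - \<epsilon>)" by (simp only: powr_add[symmetric]) simp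
  finally show thesis by (rule that)
qed

text \<open>For \<open>r \<le> 1\<close> the element \<open>x\<close> is the mean of
  \<open>u\<close> over the local interval at the scale of \<open>dyadic_scale\<close>. For
  \<open>r > 1\<close> it is 0, and the value itself is bounded by comparison with the local mean at
  \<open>k = 0\<close>: the distance contributes 2 to the constant, the mean
  \<open>L\<close>.\<close>

lemma representative_decomposition:
  fixes \<iota> :: "'b::banach \<Rightarrow> 'a::banach" and u :: "real \<Rightarrow> 'b" and w :: "real \<Rightarrow> 'a"
  assumes \<iota>: "bounded_linear \<iota>" and L: "0 \<le> L" "\<And>x. norm (\<iota> x) \<le> L * norm x"
    and T: "0 < T" and u: "u \<in> BMO_star T" and w: "w \<in> BMO_star T"
    and uw: "distributional_derivative T (\<lambda>t. \<iota> (u t)) w"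
    and t: "t \<in> {0..T}" and r: "0 < r" and \<epsilon>: "0 < \<epsilon>" "\<epsilon> < 1"
  shows "\<exists>x. norm (representative T (\<lambda>t. \<iota> (u t)) t - \<iota> x) + r * norm x
    \<le> (6 * (1 + 1 / (\<epsilon> * ln 2)) + 2 + L)
      * (enn2real (BMO_star_norm T u) + T * enn2real (BMO_star_norm T w)) * min 1 (r powr (1 - \<epsilon>))"
proof -
  let ?f = "\<lambda>t. \<iota> (u t)"
  let ?V = "representative T ?f"
  define Nu Nw where "Nu = enn2real (BMO_star_norm T u)" and "Nw = enn2real (BMO_star_norm T w)"
  have N: "0 \<le> Nu" "0 \<le> Nw" "0 \<le> T * Nw" using T by (auto simp: Nu_def Nw_def)
  have ui: "bochner_integrable (lebesgue_on {0<..<T}) u" by (rule BMO_star_integrable[OF T u])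
  have f: "bochner_integrable (lebesgue_on {0<..<T}) ?f"
    using has_bochner_bounded_linear[OF \<iota> has_bochner_bochner_integral[OF ui]]
    by (auto simp: bochner_integrable_def)
  define x where "x k = interval_mean {left_end T k t<..<left_end T k t + T / 2 ^ k} u" for k
  have J: "0 \<le> left_end T k t" "left_end T k t < left_end T k t + T / 2 ^ k" "left_end T k t + T / 2 ^ k \<le> T" for k
    using left_end_bounds[OF T f w uw t, of k] T by auto
  have mean: "local_mean T ?f k t = \<iota> (x k)" for k
    unfolding local_mean_def[OF T f w uw] x_def
    by (rule interval_mean_bounded_linear[OF \<iota> ui J])
  have x: "norm (x k) \<le> (1 + 2 * real k) * Nu" for k
    unfolding x_def Nu_def using J[of k] by (intro BMO_mean_le[OF T u]) auto
  have V: "norm (?V t - \<iota> (x k)) \<le> 1 / 2 ^ k * ((2 + 2 * real k) * (T * Nw))" for k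
    using representative_diff_local_mean_le[OF T f w uw t, of k]
    unfolding mean osc_bound_def[OF T f w uw] Nw_def by (simp add: mult_ac)
  define A where "A = 6 * (1 + 1 / (\<epsilon> * ln 2))"
  have A: "0 \<le> A" using \<epsilon> by (simp add: A_def)
  have "\<exists>x. norm (?V t - \<iota> x) + r * norm x \<le> (A + 2 + L) * (Nu + T * Nw) * min 1 (r powr (1 - \<epsilon>))"
  proof (cases "r \<le> 1")
    case True
    obtain k where k: "(2 + 2 * real k) * (1 / 2 ^ k + r) \<le> A * r powr (1 - \<epsilon>)"
      unfolding A_def using dyadic_scale[OF r True \<epsilon>(1)] by metis
    have "norm (?V t - \<iota> (x k)) + r * norm (x k)
        \<le> 1 / 2 ^ k * ((2 + 2 * real k) * (T * Nw)) + r * ((1 + 2 * real k) * Nu)"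
      using V[of k] x[of k] r by (intro add_mono mult_left_mono) auto
    also have "\<dots> \<le> 1 / 2 ^ k * ((2 + 2 * real k) * (Nu + T * Nw)) + r * ((2 + 2 * real k) * (Nu + T * Nw))"
      using N r by (intro add_mono mult_left_mono mult_mono) auto
    also have "\<dots> = (2 + 2 * real k) * (1 / 2 ^ k + r) * (Nu + T * Nw)"
    proof -
      have "p * (c * M) + r * (c * M) = c * (p + r) * M" for p c M :: real by (simp add: algebra_simps)
      then show ?thesis .
    qed
    also have "\<dots> \<le> A * r powr (1 - \<epsilon>) * (Nu + T * Nw)"
      using k N by (intro mult_right_mono) auto
    also have "\<dots> \<le> (A + 2 + L) * r powr (1 - \<epsilon>) * (Nu + T * Nw)"
      using L N by (intro mult_right_mono) auto
    also have "r powr (1 - \<epsilon>) = min 1 (r powr (1 - \<epsilon>))"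
      using r True \<epsilon> by (simp add: powr_le1)
    finally show ?thesis by (intro exI[of _ "x k"]) (simp add: mult_ac)
  next
    case False
    then have m: "min 1 (r powr (1 - \<epsilon>)) = 1"
      using \<epsilon> ge_one_powr_ge_zero[of r "1 - \<epsilon>"] by simp
    have "norm (?V t) \<le> norm (?V t - \<iota> (x 0)) + norm (\<iota> (x 0))"
      using norm_triangle_sub[of "?V t" "\<iota> (x 0)"] by simp
    also have "\<dots> \<le> 2 * (T * Nw) + L * Nu"
      using V[of 0] order_trans[OF L(2) mult_left_mono[OF x[of 0] L(1)]] by simp
    also have "\<dots> \<le> (A + 2 + L) * (T * Nw) + (A + 2 + L) * Nu"
      using A L N by (intro add_mono mult_right_mono) auto
    finally show ?thesis
      using linear_0[OF bounded_linear.linear[OF \<iota>]] by (intro exI[of _ 0]) (simp add: m algebra_simps)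
  qed
  then show ?thesis unfolding A_def Nu_def Nw_def .
qed

section \<open>The embedding\<close>

theorem theorem3p11:
  fixes j0 :: "'a::banach \<Rightarrow> 'v::{real_vector, topological_ab_group_add, t2_space}"
    and j1 :: "'b::banach \<Rightarrow> 'v"
    and \<iota> :: "'b \<Rightarrow> 'a"
    and q :: real
  assumes "banach_couple j0 j1"
    and "bounded_linear \<iota>" and "\<And>x. j0 (\<iota> x) = j1 x"
    and "1 < q"
  shows "\<exists>C::real. \<forall>T>0. \<forall>(u :: real \<Rightarrow> 'b) (u' :: real \<Rightarrow> 'a).
    u \<in> BMO_star T \<longrightarrow> u' \<in> BMO_star T \<longrightarrow>
    distributional_derivative T (\<lambda>t. \<iota> (u t)) u' \<longrightarrow>
    (\<exists>v :: real \<Rightarrow> 'v.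
       (AE t in lebesgue_on {0<..<T}. v t = j1 (u t)) \<and>
       continuous_into_interp j0 j1 (1 - 1 / q) q T v \<and>
       sup_interp_norm j0 j1 (1 - 1 / q) q T v
         \<le> ennreal C * (BMO_star_norm T u + ennreal T * BMO_star_norm T u'))"
proof -
  obtain L where L: "0 \<le> L" "\<And>x. norm (\<iota> x) \<le> L * norm x"
    using bounded_linear.nonneg_bounded[OF assms(2)] by (auto simp: mult.commute)
  interpret \<iota>: bounded_linear \<iota> by fact
  interpret j0: linear j0 using assms(1) by (simp add: banach_couple_def)
  interpret j1: linear j1 using assms(1) by (simp add: banach_couple_def)
  \<comment> \<open>The logarithm may use up half of the gap \<open>1 - \<theta> = 1 / q\<close>,
    which leaves \<open>\<tau>\<close> above \<open>\<theta>\<close>. The midpoint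
    \<open>\<sigma>\<close> of \<open>\<theta>\<close> and \<open>\<tau>\<close> is the exponent
    kept for the increments.\<close>
  define \<epsilon> \<theta> \<tau> \<sigma> where "\<epsilon> = 1 / (2 * q)" and "\<theta> = 1 - 1 / q" and "\<tau> = 1 - \<epsilon>" and "\<sigma> = 1 - 3 / (4 * q)"
  have e: "0 < \<epsilon>" "\<epsilon> < 1" "0 < \<theta>" "\<theta> < \<tau>" "\<theta> < \<sigma>" "\<sigma> < \<tau>" "0 < \<tau>" "0 < \<sigma>" "0 < q"
    using assms(4) by (auto simp: \<epsilon>_def \<theta>_def \<tau>_def \<sigma>_def field_simps)
  \<comment> \<open>It depends only on \<open>q\<close> and on the bound \<open>L\<close> of the
    embedding, and is fixed before \<open>T\<close>, \<open>u\<close> and \<open>w\<close>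
    enter.\<close>
  define A where "A = 6 * (1 + 1 / (\<epsilon> * ln 2)) + 2 + L"
  have A: "0 \<le> A" using L e by (simp add: A_def)
  define D where "D = (1 / ((\<tau> - \<theta>) * q) + 1 / (\<theta> * q)) powr (1 / q)"
  have D: "0 \<le> D" by (simp add: D_def)
  have decomp: "j0 y = j0 (y - \<iota> x) + j1 x" for x y
    by (simp add: j0.diff assms(3))
  have K_le: "K_functional j0 j1 r (j0 y) \<le> norm (y - \<iota> x) + r * norm x" if "0 < r" for r x y
    using that by (intro K_functional_le decomp) auto
  have K_nonneg: "0 \<le> K_functional j0 j1 r (j0 y)" if "0 < r" for r y
    using that by (intro K_functional_nonneg[of _ j0 "y - \<iota> 0" j1 0] decomp) auto
  have "\<exists>v :: real \<Rightarrow> 'v.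
       (AE t in lebesgue_on {0<..<T}. v t = j1 (u t)) \<and>
       continuous_into_interp j0 j1 \<theta> q T v \<and>
       sup_interp_norm j0 j1 \<theta> q T v
         \<le> ennreal (A * D) * (BMO_star_norm T u + ennreal T * BMO_star_norm T w)"
    if T: "0 < T" and u: "u \<in> BMO_star T" and w: "w \<in> BMO_star T"
      and uw: "distributional_derivative T (\<lambda>t. \<iota> (u t)) w" for T u w
  proof -
    let ?f = "\<lambda>t. \<iota> (u t)"
    define V where "V = representative T ?f"
    define N where "N = enn2real (BMO_star_norm T u) + T * enn2real (BMO_star_norm T w)"
    have N: "0 \<le> N" using T by (simp add: N_def)
    have norms: "BMO_star_norm T u + ennreal T * BMO_star_norm T w = ennreal N"
      unfolding N_def using T
      by (subst BMO_star_norm_eq[OF T u], subst BMO_star_norm_eq[OF T w]) (simp add: ennreal_mult)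
    have f: "bochner_integrable (lebesgue_on {0<..<T}) ?f"
      using has_bochner_bounded_linear[OF assms(2) has_bochner_bochner_integral[OF BMO_star_integrable[OF T u]]]
      by (auto simp: bochner_integrable_def)
    have split: "\<exists>x. norm (V t - \<iota> x) + r * norm x \<le> A * N * min 1 (r powr \<tau>)"
      if "t \<in> {0..T}" "0 < r" for t r
      unfolding V_def A_def N_def \<tau>_def
      by (rule representative_decomposition[OF assms(2) L T u w uw that e(1,2)])
    have K_V: "K_functional j0 j1 r (j0 (V t)) \<le> A * N * min 1 (r powr \<tau>)" if t: "t \<in> {0..T}" and r: "0 < r" for t r
      using split[OF t r] K_le[OF r] by (meson order_trans)
    have AN: "0 \<le> A * N" using A N by simp
    \<comment> \<open>The difference of the splittings of \<open>V s\<close> and \<open>V t\<close>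
      at the same \<open>r\<close> splits \<open>V s - V t\<close>.\<close>
    have K_diff: "K_functional j0 j1 r (j0 (V s - V t)) \<le> 2 * (A * N) * min 1 (r powr \<tau>)"
      if s: "s \<in> {0..T}" and t: "t \<in> {0..T}" and r: "0 < r" for s t r
    proof -
      obtain x y where x: "norm (V s - \<iota> x) + r * norm x \<le> A * N * min 1 (r powr \<tau>)"
        and y: "norm (V t - \<iota> y) + r * norm y \<le> A * N * min 1 (r powr \<tau>)"
        using split[OF s r] split[OF t r] by blast
      have "K_functional j0 j1 r (j0 (V s - V t)) \<le> norm (V s - V t - \<iota> (x - y)) + r * norm (x - y)"
        by (rule K_le[OF r])
      also have "V s - V t - \<iota> (x - y) = (V s - \<iota> x) - (V t - \<iota> y)"
        by (simp add: \<iota>.diff)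
      also have "norm ((V s - \<iota> x) - (V t - \<iota> y)) + r * norm (x - y)
          \<le> (norm (V s - \<iota> x) + norm (V t - \<iota> y)) + r * (norm x + norm y)"
        using r by (intro add_mono norm_triangle_ineq4 mult_left_mono) auto
      also have "\<dots> \<le> 2 * (A * N) * min 1 (r powr \<tau>)"
        using x y by (simp add: algebra_simps)
      finally show ?thesis .
    qed
    have norm_V: "interp_norm j0 j1 \<theta> q (j0 (V t)) \<le> A * N * D" if t: "t \<in> {0..T}" for t
      unfolding D_def by (rule interp_norm_le[OF e(3,4,9) AN K_nonneg K_V[OF t]])
    \<comment> \<open>Membership is proved apart from the norm bound, since
      \<open>interp_norm\<close> takes the value 0 when the integral is infinite.\<close>
    have in_space: "j0 (V t) \<in> interp_space j0 j1 \<theta> q" if t: "t \<in> {0..T}" for t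
    proof -
      have "j0 (V t) = j0 (V t) + j1 0" by (simp add: j1.zero)
      then have "j0 (V t) \<in> couple_sum j0 j1" unfolding couple_sum_def by blast
      moreover have "interp_integral j0 j1 \<theta> q (j0 (V t))
          \<le> ennreal ((A * N) powr q * (1 / ((\<tau> - \<theta>) * q) + 1 / (\<theta> * q)))"
        by (rule interp_integral_le[OF e(3,4,9) AN K_nonneg K_V[OF t]])
      then have "interp_integral j0 j1 \<theta> q (j0 (V t)) < \<infinity>"
        by (rule le_less_trans) simp
      ultimately show ?thesis by (simp add: interp_space_def)
    qed
    \<comment> \<open>Putting weight \<open>\<eta>\<close> on the increment in the larger space
      lowers the power of \<open>r\<close> from \<open>\<tau>\<close> to
      \<open>\<tau> * (1 - \<eta>) = \<sigma>\<close>, still above \<open>\<theta>\<close>, and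
      leaves a positive power of the increment as a factor.\<close>
    define \<eta> where "\<eta> = 1 - \<sigma> / \<tau>"
    have \<eta>: "0 < \<eta>" "\<eta> < 1" "\<tau> * (1 - \<eta>) = \<sigma>" using e by (auto simp: \<eta>_def)
    define E where "E = (2 * (A * N)) powr (1 - \<eta>) * (1 / ((\<sigma> - \<theta>) * q) + 1 / (\<theta> * q)) powr (1 / q)"
    have norm_diff: "interp_norm j0 j1 \<theta> q (j0 (V s) - j0 (V t)) \<le> norm (V s - V t) powr \<eta> * E"
      if s: "s \<in> {0..T}" and t: "t \<in> {0..T}" for s t
    proof -
      have "K_functional j0 j1 r (j0 (V s - V t))
          \<le> norm (V s - V t) powr \<eta> * (2 * (A * N)) powr (1 - \<eta>) * min 1 (r powr \<sigma>)" if r: "0 < r" for r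
      proof -
        have "K_functional j0 j1 r (j0 (V s - V t)) \<le> norm (V s - V t)"
          using K_le[OF r, of "V s - V t" 0] by (simp add: \<iota>.zero)
        from le_geometric_mean[OF K_nonneg[OF r] this K_diff[OF s t r] \<eta>(1,2)]
        have "K_functional j0 j1 r (j0 (V s - V t))
          \<le> norm (V s - V t) powr \<eta> * (2 * (A * N) * min 1 (r powr \<tau>)) powr (1 - \<eta>)" .
        also have "(2 * (A * N) * min 1 (r powr \<tau>)) powr (1 - \<eta>)
            = (2 * (A * N)) powr (1 - \<eta>) * (min 1 (r powr \<tau>)) powr (1 - \<eta>)"
          by (rule powr_mult)
        also have "(min 1 (r powr \<tau>)) powr (1 - \<eta>) = min 1 (r powr \<sigma>)"
        proof (cases "r \<le> 1")
          case True
          then have "r powr \<tau> \<le> 1" "r powr \<sigma> \<le> 1" using e r by (auto intro: powr_le1)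
          then show ?thesis by (simp add: powr_powr \<eta>(3))
        next
          case False
          then have "1 \<le> r powr \<tau>" "1 \<le> r powr \<sigma>" using e by (auto intro: ge_one_powr_ge_zero)
          then show ?thesis by simp
        qed
        finally show ?thesis by (simp add: mult.assoc)
      qed
      from interp_norm_le[OF e(3,5,9) _ K_nonneg this]
      show ?thesis by (simp add: E_def j0.diff mult.assoc)
    qed
    have "((\<lambda>s. interp_norm j0 j1 \<theta> q (j0 (V s) - j0 (V t))) \<longlongrightarrow> 0) (at t within {0..T})" if t: "t \<in> {0..T}" for t
    proof (rule tendsto_sandwich[OF _ _ tendsto_const])
      have "(V \<longlongrightarrow> V t) (at t within {0..T})"
        using representative_continuous[OF T f w uw] t unfolding V_def continuous_on_def by blast
      then have "((\<lambda>s. norm (V s - V t)) \<longlongrightarrow> 0) (at t within {0..T})"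
        by (simp add: LIM_zero tendsto_norm_zero)
      then have "((\<lambda>s. norm (V s - V t) powr \<eta> * E) \<longlongrightarrow> 0 powr \<eta> * E) (at t within {0..T})"
        using \<eta>(1) by (intro tendsto_mult tendsto_powr' tendsto_const) auto
      then show "((\<lambda>s. norm (V s - V t) powr \<eta> * E) \<longlongrightarrow> 0) (at t within {0..T})" by simp
      show "\<forall>\<^sub>F s in at t within {0..T}. interp_norm j0 j1 \<theta> q (j0 (V s) - j0 (V t)) \<le> norm (V s - V t) powr \<eta> * E"
        using norm_diff t by (auto simp: eventually_at_filter)
      show "\<forall>\<^sub>F s in at t within {0..T}. 0 \<le> interp_norm j0 j1 \<theta> q (j0 (V s) - j0 (V t))"
        by (simp add: interp_norm_def)
    qed
    then have "continuous_into_interp j0 j1 \<theta> q T (\<lambda>t. j0 (V t))"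
      using in_space by (simp add: continuous_into_interp_def)
    moreover have "AE t in lebesgue_on {0<..<T}. j0 (V t) = j1 (u t)"
      using representative_AE_eq[OF T f w uw] unfolding V_def by eventually_elim (simp add: assms(3))
    moreover have "sup_interp_norm j0 j1 \<theta> q T (\<lambda>t. j0 (V t)) \<le> ennreal (A * D) * ennreal N"
      unfolding sup_interp_norm_def
    proof (rule SUP_least)
      fix t assume "t \<in> {0..T}"
      from norm_V[OF this] have "ennreal (interp_norm j0 j1 \<theta> q (j0 (V t))) \<le> ennreal (A * D * N)"
        by (intro ennreal_leI) (simp add: mult_ac)
      also have "\<dots> = ennreal (A * D) * ennreal N"
        using A D N by (simp add: ennreal_mult)
      finally show "ennreal (interp_norm j0 j1 \<theta> q (j0 (V t))) \<le> ennreal (A * D) * ennreal N" .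
    qed
    ultimately show ?thesis
      unfolding norms by (intro exI[of _ "\<lambda>t. j0 (V t)"] conjI)
  qed
  then show ?thesis unfolding \<theta>_def by blast
qed

end
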